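(* Let $N\ge 2$. For every $\Lambda>1$, the problem $$\begin{cases} -\Delta u = u-u^3-\Lambda uv^2\\ -\Delta v = v-v^3-\Lambda u^2 v\\ u,v>0\end{cases}\qquad \text{in } \mathbb{R}^N$$ has infinitely many geometrically distinct non-constant solutions.
   Context: Solutions are understood in the classical sense. Two solutions $(u,v)$ and $(\tilde u,\tilde v)$ are geometrically distinct if neither of the pairs $(u,v)$, $(v,u)$ can be obtained from $(\tilde u,\tilde v)$ by composition with an isometry (rigid motion) of $\mathbb{R}^N$. *)

theory Defs
  imports "HOL-Analysis.Analysis"
begin

definition partial_deriv :: "'n::finite \<Rightarrow> (real^'n \<Rightarrow> real) \<Rightarrow> real^'n \<Rightarrow> real" where
  "partial_deriv i f x = frechet_derivative f (at x) (axis i 1)"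

definition C1_fun :: "(real^'n::finite \<Rightarrow> real) \<Rightarrow> bool" where
  "C1_fun f \<longleftrightarrow> (\<forall>x. f differentiable (at x)) \<and> (\<forall>i. continuous_on UNIV (partial_deriv i f))"

definition C2_fun :: "(real^'n::finite \<Rightarrow> real) \<Rightarrow> bool" where
  "C2_fun f \<longleftrightarrow> C1_fun f \<and> (\<forall>i. C1_fun (partial_deriv i f))"

(* For f not twice differentiable the value is arbitrary; it is used below only together
   with C2_fun. *)
definition laplacian :: "(real^'n::finite \<Rightarrow> real) \<Rightarrow> real^'n \<Rightarrow> real" where
  "laplacian f x = (\<Sum>i\<in>UNIV. partial_deriv i (partial_deriv i f) x)"

definition classical_solution ::
    "real \<Rightarrow> (real^'n::finite \<Rightarrow> real) \<times> (real^'n \<Rightarrow> real) \<Rightarrow> bool" where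
  "classical_solution \<Lambda> = (\<lambda>(u, v). C2_fun u \<and> C2_fun v \<and>
     (\<forall>x. - laplacian u x = u x - u x ^ 3 - \<Lambda> * u x * v x ^ 2) \<and>
     (\<forall>x. - laplacian v x = v x - v x ^ 3 - \<Lambda> * u x ^ 2 * v x) \<and>
     (\<forall>x. u x > 0) \<and> (\<forall>x. v x > 0))"

definition constant_pair :: "(real^'n::finite \<Rightarrow> real) \<times> (real^'n \<Rightarrow> real) \<Rightarrow> bool" where
  "constant_pair = (\<lambda>(u, v). u constant_on UNIV \<and> v constant_on UNIV)"

(* Surjectivity is automatic for a distance-preserving self-map of R^N. *)
definition isometry :: "(real^'n::finite \<Rightarrow> real^'n) \<Rightarrow> bool" where
  "isometry T \<longleftrightarrow> (\<forall>x y. dist (T x) (T y) = dist x y)"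

definition geometrically_distinct ::
    "(real^'n::finite \<Rightarrow> real) \<times> (real^'n \<Rightarrow> real) \<Rightarrow> (real^'n \<Rightarrow> real) \<times> (real^'n \<Rightarrow> real) \<Rightarrow> bool" where
  "geometrically_distinct = (\<lambda>(u, v) (u', v'). \<not> (\<exists>T. isometry T \<and>
     ((u, v) = (u' \<circ> T, v' \<circ> T) \<or> (v, u) = (u' \<circ> T, v' \<circ> T))))"

end

theory Submission
  imports Defs
begin

text \<open>
The solutions constructed here depend on one coordinate only: they are periodic solutions of the
one-dimensional system, oscillating about the constant solution \<open>u = v\<close>, one for every half period
\<open>M\<close> above a critical value.

In the coordinates \<open>s = u + v\<close> and \<open>d = u - v\<close> the system is \<open>- s'' = F s d\<close>, \<open>- d'' = F d s\<close> with one
function \<open>F\<close> (\<open>reaction\<close>). Linearised at the constant state \<open>s = s0 = 2 / sqrt (1 + \<Lambda>)\<close>, \<open>d = 0\<close>, the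
component \<open>d\<close> oscillates with squared frequency \<open>\<omega>^2 = 2 (\<Lambda> - 1) / (\<Lambda> + 1)\<close>, which is positive exactly
because \<open>\<Lambda> > 1\<close>. For \<open>M > pi / \<omega>\<close> a solution on \<open>[0, M]\<close> with Neumann conditions for \<open>s\<close> and
Dirichlet conditions for \<open>d\<close>, and with \<open>d > 0\<close> inside, is found by monotone iteration. The system is
cooperative in \<open>(s, d)\<close> if \<open>\<Lambda> \<ge> 3\<close> and cooperative in \<open>(- s, d)\<close> if \<open>\<Lambda> \<le> 3\<close>. In this order
\<open>(s0, \<epsilon> sin (pi x / M))\<close> is a lower barrier for small \<open>\<epsilon>\<close>, since \<open>pi / M < \<omega>\<close>, and \<open>(1, 1)\<close> is an
upper one. The iterates increase from the lower barrier; all comparisons rest on \<open>max_principle\<close>, and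
\<open>jet_limit\<close> shows that the pointwise limit solves the equations (\<open>half_period_solution\<close>). The iteration
also preserves \<open>d \<le> s\<close>, and an exponential barrier improves this to \<open>d < s\<close>, so that \<open>u\<close> and \<open>v\<close> are
positive (\<open>difference_below_sum\<close>).

Even reflection of \<open>s\<close> and odd reflection of \<open>d\<close> extend the solution to the line
(\<open>periodic_profile\<close>), and composition with a coordinate gives a classical solution on the whole space.
Its coincidence set \<open>u = v\<close> consists of parallel hyperplanes at mutual distance \<open>M\<close>. The radii of balls
that avoid the coincidence set are invariant under rigid motions and under the exchange of \<open>u\<close> and \<open>v\<close>
(\<open>separates_invariant\<close>), and the largest one is \<open>M / 2\<close> (\<open>lifted_solution\<close>); so different half periods
give geometrically distinct solutions, none of them constant.
\<close>

section \<open>Two-point boundary value problems on an interval\<close>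

text \<open>A function together with its first two derivatives on a closed interval, one-sided at the ends.
Carrying the derivatives along as functions lets boundary conditions such as \<open>p 0 = 0\<close> be
stated directly and lets differential equations be written as the choice of \<open>q\<close>.\<close>

definition jet :: "real \<Rightarrow> (real \<Rightarrow> real) \<Rightarrow> (real \<Rightarrow> real) \<Rightarrow> (real \<Rightarrow> real) \<Rightarrow> bool" where
  "jet M w p q \<longleftrightarrow> (\<forall>x\<in>{0..M}. (w has_real_derivative p x) (at x within {0..M}) \<and>
     (p has_real_derivative q x) (at x within {0..M}))"

lemma jet_continuous: "jet M w p q \<Longrightarrow> continuous_on {0..M} w"
  unfolding jet_def by (blast intro: DERIV_continuous_on)

lemma jet_diff: "jet M w p q \<Longrightarrow> jet M w' p' q' \<Longrightarrow>
   jet M (\<lambda>x. w x - w' x) (\<lambda>x. p x - p' x) (\<lambda>x. q x - q' x)"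
  unfolding jet_def by (auto intro!: DERIV_diff)

lemma jet_cmult: "jet M w p q \<Longrightarrow> jet M (\<lambda>x. c * w x) (\<lambda>x. c * p x) (\<lambda>x. c * q x)" for c :: real
  unfolding jet_def by (auto intro!: DERIV_cmult)

lemma jet_add: "jet M w p q \<Longrightarrow> jet M w' p' q' \<Longrightarrow>
   jet M (\<lambda>x. w x + w' x) (\<lambda>x. p x + p' x) (\<lambda>x. q x + q' x)"
  unfolding jet_def by (auto intro!: DERIV_add)

lemma jet_const: "jet M (\<lambda>x. c) (\<lambda>x. 0) (\<lambda>x. 0)"
  unfolding jet_def by auto

lemma jet_mvt:
  assumes "jet M w p q" "0 \<le> a" "a < b" "b \<le> M"
  obtains z where "a < z" "z < b" "w b - w a = p z * (b - a)"
proof -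
  have "\<exists>z\<in>{a<..<b}. w b - w a = (\<lambda>h. p z * h) (b - a)"
  proof (rule mvt_simple)
    fix x assume "a \<le> x" "x \<le> b"
    then have "(w has_real_derivative p x) (at x within {0..M})"
      using assms by (auto simp: jet_def)
    then have "(w has_real_derivative p x) (at x within {a..b})"
      by (rule has_field_derivative_subset) (use assms in auto)
    then show "(w has_derivative (*) (p x)) (at x within {a..b})"
      by (simp add: has_field_derivative_def)
  qed (use assms in auto)
  then show ?thesis using that by auto
qed

text \<open>At a negative minimum the second derivative would be negative, so the function would drop further
on at least one side. A Neumann condition plays the part of the vanishing first derivative when
the minimum sits at an end point, which is why each end may carry either kind of condition.\<close>

lemma max_principle:
  fixes K M :: real
  assumes "M > 0" "K > 0" and J: "jet M w p q"
    and q: "\<And>x. x \<in> {0..M} \<Longrightarrow> q x \<le> K * w x"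
    and l: "w 0 \<ge> 0 \<or> p 0 = 0" and r: "w M \<ge> 0 \<or> p M = 0"
    and x: "x \<in> {0..M}"
  shows "w x \<ge> 0"
proof (rule ccontr)
  assume neg: "\<not> w x \<ge> 0"
  obtain x0 where x0: "x0 \<in> {0..M}" and min: "\<And>y. y \<in> {0..M} \<Longrightarrow> w x0 \<le> w y"
    using continuous_attains_inf[OF compact_Icc _ jet_continuous[OF J]] x by blast
  have wx0: "w x0 < 0" using min[OF x] neg by linarith
  have "q x0 < 0"
    using q[OF x0] mult_pos_neg[OF \<open>K > 0\<close> wx0] by linarith
  have dp: "(p has_real_derivative q x0) (at x0 within {0..M})"
    and dw: "(w has_real_derivative p x0) (at x0 within {0..M})" using J x0 by (auto simp: jet_def)
  have p0: "p x0 = 0"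
  proof (cases "x0 = 0 \<or> x0 = M")
    case True
    then show ?thesis using l r wx0 by auto
  next
    case False
    then have i: "0 < x0" "x0 < M" using x0 by auto
    then have "(w has_real_derivative p x0) (at x0)"
      using dw by (simp add: at_within_Icc_at)
    then show ?thesis
    proof (rule DERIV_local_min)
      show "0 < Min {x0, M - x0}" using i by simp
      show "\<forall>y. \<bar>x0 - y\<bar> < Min {x0, M - x0} \<longrightarrow> w x0 \<le> w y"
        by (intro allI impI min) (auto simp: abs_less_iff)
    qed
  qed
  show False
  proof (cases "x0 < M")
    case True
    obtain \<delta> where \<delta>: "\<delta> > 0" "\<And>h. h > 0 \<Longrightarrow> x0 + h \<in> {0..M} \<Longrightarrow> h < \<delta> \<Longrightarrow> p x0 > p (x0 + h)"
      using has_real_derivative_neg_dec_right[OF dp \<open>q x0 < 0\<close>] by blast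
    define y where "y = min (x0 + \<delta>) M"
    have y: "x0 < y" "y \<le> M" "y \<le> x0 + \<delta>" using True \<delta> by (auto simp: y_def)
    obtain z where z: "x0 < z" "z < y" "w y - w x0 = p z * (y - x0)"
      using jet_mvt[OF J, of x0 y] x0 y by auto
    have "p z < 0" using \<delta>(2)[of "z - x0"] z y x0 p0 by auto
    then have "p z * (y - x0) < 0" using y by (simp add: mult_neg_pos)
    then show False using z min[of y] y x0 by auto
  next
    case False
    then have M: "x0 = M" using x0 by auto
    obtain \<delta> where \<delta>: "\<delta> > 0" "\<And>h. h > 0 \<Longrightarrow> x0 - h \<in> {0..M} \<Longrightarrow> h < \<delta> \<Longrightarrow> p x0 < p (x0 - h)"
      using has_real_derivative_neg_dec_left[OF dp \<open>q x0 < 0\<close>] by blast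
    define y where "y = max (x0 - \<delta>) 0"
    have y: "y < x0" "0 \<le> y" "x0 - \<delta> \<le> y" using \<open>M > 0\<close> M \<delta> by (auto simp: y_def)
    obtain z where z: "y < z" "z < x0" "w x0 - w y = p z * (x0 - y)"
      using jet_mvt[OF J, of y x0] x0 y by auto
    have "p z > 0" using \<delta>(2)[of "x0 - z"] z y x0 p0 by auto
    then have "p z * (x0 - y) > 0" using y by simp
    then show False using z min[of y] y x0 by auto
  qed
qed

lemma jet_exp: "jet M (\<lambda>x. c * exp (k * x)) (\<lambda>x. c * (k * exp (k * x))) (\<lambda>x. k\<^sup>2 * (c * exp (k * x)))"
  unfolding jet_def by (auto intro!: derivative_eq_intros simp: power2_eq_square)

lemma jet_sin: "jet M (\<lambda>x. c * sin (k * x)) (\<lambda>x. c * (k * cos (k * x))) (\<lambda>x. - (k\<^sup>2 * (c * sin (k * x))))"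
  unfolding jet_def by (auto intro!: derivative_eq_intros simp: power2_eq_square)

lemma jet_cosh: "jet M (\<lambda>x. c * cosh (k * x)) (\<lambda>x. c * (k * sinh (k * x))) (\<lambda>x. k\<^sup>2 * (c * cosh (k * x)))"
  for c :: real
  unfolding jet_def by (auto intro!: derivative_eq_intros simp: power2_eq_square)

lemma jet_sinh: "jet M (\<lambda>x. c * sinh (k * x)) (\<lambda>x. c * (k * cosh (k * x))) (\<lambda>x. k\<^sup>2 * (c * sinh (k * x)))"
  for c :: real
  unfolding jet_def by (auto intro!: derivative_eq_intros simp: power2_eq_square)

text \<open>Variation of parameters: \<open>w x\<close> is the integral of \<open>- sinh (k (x - t)) / k * g t\<close> from \<open>0\<close> to \<open>x\<close>,
split by the addition theorem so that the integrands do not depend on \<open>x\<close>.\<close>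

lemma particular_solution:
  fixes k M :: real
  assumes "k > 0" and g: "continuous_on {0..M} g"
  obtains w p where "jet M w p (\<lambda>x. k\<^sup>2 * w x - g x)" "w 0 = 0" "p 0 = 0"
proof -
  define C where "C x = integral {0..x} (\<lambda>t. cosh (k * t) * g t)" for x
  define S where "S x = integral {0..x} (\<lambda>t. sinh (k * t) * g t)" for x
  have C: "(C has_real_derivative cosh (k * x) * g x) (at x within {0..M})" if "x \<in> {0..M}" for x
    unfolding C_def by (rule integral_has_real_derivative[OF _ that]) (intro continuous_intros g)
  have S: "(S has_real_derivative sinh (k * x) * g x) (at x within {0..M})" if "x \<in> {0..M}" for x
    unfolding S_def by (rule integral_has_real_derivative[OF _ that]) (intro continuous_intros g)
  define w where "w x = (cosh (k * x) * S x - sinh (k * x) * C x) / k" for x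
  define p where "p x = sinh (k * x) * S x - cosh (k * x) * C x" for x
  have "(w has_real_derivative p x) (at x within {0..M})" if "x \<in> {0..M}" for x
    unfolding w_def p_def using \<open>k > 0\<close>
    by (auto intro!: derivative_eq_intros C[OF that] S[OF that] simp: field_simps)
  moreover have "(p has_real_derivative k\<^sup>2 * w x - g x) (at x within {0..M})" if "x \<in> {0..M}" for x
  proof -
    have "cosh (k * x) * cosh (k * x) = 1 + sinh (k * x) * sinh (k * x)"
      using cosh_square_eq[of "k * x"] by (simp add: power2_eq_square)
    then have "g x * (cosh (k * x) * cosh (k * x)) = g x + g x * (sinh (k * x) * sinh (k * x))"
      by (simp add: algebra_simps)
    then show ?thesis
      unfolding w_def p_def using \<open>k > 0\<close>
      by (auto intro!: derivative_eq_intros C[OF that] S[OF that] simp: power2_eq_square field_simps)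
  qed
  moreover have "w 0 = 0" "p 0 = 0" by (auto simp: w_def p_def C_def S_def)
  ultimately show ?thesis by (intro that[of w p]) (auto simp: jet_def)
qed

lemma dirichlet_problem:
  fixes k M :: real
  assumes "k > 0" "M > 0" and g: "continuous_on {0..M} g"
  obtains w p where "jet M w p (\<lambda>x. k\<^sup>2 * w x - g x)" "w 0 = 0" "w M = 0"
proof -
  obtain w p where w: "jet M w p (\<lambda>x. k\<^sup>2 * w x - g x)" "w 0 = 0"
    using particular_solution[OF assms(1) g] by metis
  have "sinh (k * M) > 0" using assms by simp
  then show ?thesis using w
      jet_add[OF w(1) jet_sinh[of M "- w M / sinh (k * M)" k]]
    by (intro that[of "\<lambda>x. w x + - w M / sinh (k * M) * sinh (k * x)"]) (auto simp: algebra_simps)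
qed

lemma neumann_problem:
  fixes k M :: real
  assumes "k > 0" "M > 0" and g: "continuous_on {0..M} g"
  obtains w p where "jet M w p (\<lambda>x. k\<^sup>2 * w x - g x)" "p 0 = 0" "p M = 0"
proof -
  obtain w p where w: "jet M w p (\<lambda>x. k\<^sup>2 * w x - g x)" "p 0 = 0"
    using particular_solution[OF assms(1) g] by metis
  define A where "A = - p M / (k * sinh (k * M))"
  have "k * sinh (k * M) > 0" using assms by simp
  then have A: "A * (k * sinh (k * M)) = - p M"
    unfolding A_def by (metis less_irrefl nonzero_eq_divide_eq)
  show ?thesis using w A jet_add[OF w(1) jet_cosh[of M A k]]
    by (intro that[of "\<lambda>x. w x + A * cosh (k * x)" "\<lambda>x. p x + A * (k * sinh (k * x))"])
       (auto simp: algebra_simps)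
qed

text \<open>Taylor's formula with integral remainder expresses a function by its boundary data at \<open>0\<close> and by
its second derivative alone; in this form the equation survives pointwise limits.\<close>

lemma jet_taylor:
  assumes J: "jet M w p q" and x: "x \<in> {0..M}"
  shows "(q has_integral p x - p 0) {0..x}"
    and "((\<lambda>t. (x - t) * q t) has_integral w x - w 0 - p 0 * x) {0..x}"
proof -
  have w: "(w has_real_derivative p t) (at t within {0..x})"
    and p: "(p has_real_derivative q t) (at t within {0..x})" if "t \<in> {0..x}" for t
    using J x that has_field_derivative_subset[of _ _ t "{0..M}" "{0..x}"] by (auto simp: jet_def)
  show "(q has_integral p x - p 0) {0..x}"
    using p x by (intro fundamental_theorem_of_calculus)
      (auto simp: has_real_derivative_iff_has_vector_derivative)
  have "((\<lambda>t. (x - t) * q t) has_integral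
      ((x - x) * p x + w x) - ((x - 0) * p 0 + w 0)) {0..x}"
  proof (rule fundamental_theorem_of_calculus)
    fix t assume t: "t \<in> {0..x}"
    show "((\<lambda>t. (x - t) * p t + w t) has_vector_derivative (x - t) * q t) (at t within {0..x})"
      unfolding has_real_derivative_iff_has_vector_derivative[symmetric]
      by (auto intro!: derivative_eq_intros w[OF t] p[OF t])
  qed (use x in auto)
  then show "((\<lambda>t. (x - t) * q t) has_integral w x - w 0 - p 0 * x) {0..x}"
    by (simp add: algebra_simps)
qed

text \<open>If functions and their second derivatives converge pointwise, the latter boundedly, then dominated
convergence in Taylor's formula shows that the limit satisfies the same formula. The
slopes \<open>p n 0\<close> converge because Taylor's formula at \<open>x = M\<close> determines them.
The limit of the second derivatives is a priori only integrable, so continuity of \<open>W\<close> comes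
first; in the application it makes \<open>Q\<close> continuous, and only then is \<open>W\<close> twice differentiable.\<close>

lemma jet_limit:
  fixes M B :: real
  assumes "M > 0" and J: "\<And>n. jet M (w n) (p n) (q n)"
    and bnd: "\<And>n x. x \<in> {0..M} \<Longrightarrow> \<bar>q n x\<bar> \<le> B"
    and wl: "\<And>x. x \<in> {0..M} \<Longrightarrow> (\<lambda>n. w n x) \<longlonglongrightarrow> W x"
    and ql: "\<And>x. x \<in> {0..M} \<Longrightarrow> (\<lambda>n. q n x) \<longlonglongrightarrow> Q x"
  obtains P where "continuous_on {0..M} W"
    and "continuous_on {0..M} Q \<Longrightarrow> jet M W P Q"
    and "(\<lambda>n. p n 0) \<longlonglongrightarrow> P 0" and "(\<lambda>n. p n M) \<longlonglongrightarrow> P M"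
proof -
  have Qi: "Q integrable_on {0..x}" and Ql: "(\<lambda>n. p n x - p n 0) \<longlonglongrightarrow> integral {0..x} Q"
    and tQi: "(\<lambda>t. t * Q t) integrable_on {0..x}"
    and tQl: "(\<lambda>n. w n x - w n 0 - p n 0 * x) \<longlonglongrightarrow> x * integral {0..x} Q - integral {0..x} (\<lambda>t. t * Q t)"
    if x: "x \<in> {0..M}" for x
  proof -
    have 1: "q n integrable_on {0..x}" "integral {0..x} (q n) = p n x - p n 0" for n
      using jet_taylor(1)[OF J x, of n] by (auto simp: has_integral_iff)
    show a: "Q integrable_on {0..x}"
      using x bnd ql by (intro dominated_convergence(1)[of q "{0..x}" "\<lambda>_. B" Q]) (auto intro: 1)
    have "(\<lambda>n. integral {0..x} (q n)) \<longlonglongrightarrow> integral {0..x} Q"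
      using x bnd ql by (intro dominated_convergence(2)[of q "{0..x}" "\<lambda>_. B" Q]) (auto intro: 1)
    then show "(\<lambda>n. p n x - p n 0) \<longlonglongrightarrow> integral {0..x} Q" by (simp add: 1)
    have 2: "(\<lambda>t. (x - t) * q n t) integrable_on {0..x}"
      "integral {0..x} (\<lambda>t. (x - t) * q n t) = w n x - w n 0 - p n 0 * x" for n
      using jet_taylor(2)[OF J x, of n] by (auto simp: has_integral_iff)
    have le: "norm ((x - t) * q n t) \<le> M * B" if "t \<in> {0..x}" for t n
    proof -
      have "\<bar>x - t\<bar> * \<bar>q n t\<bar> \<le> M * B"
        using that x bnd[of t n] by (intro mult_mono) auto
      then show ?thesis by (simp add: abs_mult)
    qed
    have lim: "(\<lambda>n. (x - t) * q n t) \<longlonglongrightarrow> (x - t) * Q t" if "t \<in> {0..x}" for t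
      using that x by (intro tendsto_intros ql) auto
    have b: "(\<lambda>t. (x - t) * Q t) integrable_on {0..x}"
      by (rule dominated_convergence(1)[OF 2(1) _ le lim]) auto
    have "(\<lambda>t. x * Q t - (x - t) * Q t) integrable_on {0..x}"
      by (intro integrable_diff integrable_on_mult_right a b)
    then show c: "(\<lambda>t. t * Q t) integrable_on {0..x}" by (simp add: algebra_simps)
    have "(\<lambda>n. integral {0..x} (\<lambda>t. (x - t) * q n t)) \<longlonglongrightarrow> integral {0..x} (\<lambda>t. (x - t) * Q t)"
      by (rule dominated_convergence(2)[OF 2(1) _ le lim]) auto
    moreover have "integral {0..x} (\<lambda>t. (x - t) * Q t) =
        x * integral {0..x} Q - integral {0..x} (\<lambda>t. t * Q t)"
      using integral_diff[OF integrable_on_mult_right[OF a, of x] c] by (simp add: left_diff_distrib)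
    ultimately show "(\<lambda>n. w n x - w n 0 - p n 0 * x) \<longlonglongrightarrow>
        x * integral {0..x} Q - integral {0..x} (\<lambda>t. t * Q t)"
      by (simp add: 2)
  qed
  define I where "I x = integral {0..x} Q" for x
  define I1 where "I1 x = integral {0..x} (\<lambda>t. t * Q t)" for x
  \<comment> \<open>the limit of the slopes at 0, from Taylor's formula at M\<close>
  define c where "c = (W M - W 0 - (M * I M - I1 M)) / M"
  have M: "M \<in> {0..M}" "0 \<in> {0..M}" using \<open>M > 0\<close> by auto
  have "(\<lambda>n. ((w n M - w n 0) - (w n M - w n 0 - p n 0 * M)) / M) \<longlonglongrightarrow> c"
    unfolding c_def I_def I1_def using \<open>M > 0\<close> by (intro tendsto_intros wl tQl M) auto
  then have p0: "(\<lambda>n. p n 0) \<longlonglongrightarrow> c" using \<open>M > 0\<close> by simp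
  have W: "W x = W 0 + c * x + (x * I x - I1 x)" if x: "x \<in> {0..M}" for x
  proof (rule LIMSEQ_unique[OF wl[OF x]])
    have "(\<lambda>n. w n 0 + p n 0 * x + (w n x - w n 0 - p n 0 * x)) \<longlonglongrightarrow>
        W 0 + c * x + (x * I x - I1 x)"
      unfolding I_def I1_def by (intro tendsto_intros wl M p0 tQl x)
    then show "(\<lambda>n. w n x) \<longlonglongrightarrow> W 0 + c * x + (x * I x - I1 x)" by simp
  qed
  define P where "P x = c + I x" for x
  show ?thesis
  proof (rule that[of P])
    have "continuous_on {0..M} (\<lambda>x. W 0 + c * x + (x * I x - I1 x))"
      unfolding I_def I1_def
      by (intro continuous_intros indefinite_integral_continuous_1 Qi tQi M)
    then show "continuous_on {0..M} W"
      by (rule continuous_on_eq) (rule W[symmetric])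
    show "(\<lambda>n. p n 0) \<longlonglongrightarrow> P 0" using p0 by (simp add: P_def I_def)
    have "(\<lambda>n. p n 0 + (p n M - p n 0)) \<longlonglongrightarrow> P M"
      unfolding P_def I_def by (intro tendsto_intros p0 Ql M)
    then show "(\<lambda>n. p n M) \<longlonglongrightarrow> P M" by simp
    assume cQ: "continuous_on {0..M} Q"
    show "jet M W P Q"
      unfolding jet_def
    proof (intro ballI conjI)
      fix x assume x: "x \<in> {0..M}"
      have I: "(I has_real_derivative Q x) (at x within {0..M})"
        unfolding I_def by (rule integral_has_real_derivative[OF cQ x])
      have I1: "(I1 has_real_derivative x * Q x) (at x within {0..M})"
        unfolding I1_def by (rule integral_has_real_derivative[OF _ x]) (intro continuous_intros cQ)
      show "(P has_real_derivative Q x) (at x within {0..M})"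
        unfolding P_def by (auto intro!: derivative_eq_intros I)
      have "((\<lambda>x. W 0 + c * x + (x * I x - I1 x)) has_real_derivative P x) (at x within {0..M})"
        unfolding P_def by (auto intro!: derivative_eq_intros I I1)
      then show "(W has_real_derivative P x) (at x within {0..M})"
        by (rule has_field_derivative_transform_within[OF _ zero_less_one x]) (rule W[symmetric])
    qed
  qed
qed

section \<open>The nonlinearity in sum and difference coordinates\<close>

text \<open>For \<open>s = u + v\<close> and \<open>d = u - v\<close> the system reads \<open>- s'' = reaction \<Lambda> s d\<close> and \<open>- d'' = reaction \<Lambda> d s\<close>:
the same nonlinearity with the roles exchanged.\<close>

definition reaction :: "real \<Rightarrow> real \<Rightarrow> real \<Rightarrow> real" where
  "reaction \<Lambda> a b = a * (1 - (1 + \<Lambda>) / 4 * a\<^sup>2 + (\<Lambda> - 3) / 4 * b\<^sup>2)"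

text \<open>The linear term moves to the left side of the equation, as \<open>- w'' + K w\<close> with
\<open>K = 4 (1 + \<Lambda>)\<close>. This value makes the right side increasing in its own variable and preserves
the inequality \<open>d \<le> s\<close>, for arguments between \<open>0\<close> and \<open>2\<close>.\<close>

definition shifted :: "real \<Rightarrow> real \<Rightarrow> real \<Rightarrow> real" where
  "shifted \<Lambda> a b = 4 * (1 + \<Lambda>) * a + reaction \<Lambda> a b"

lemma shifted_mono_left:
  assumes "\<Lambda> > 1" "0 \<le> a" "a \<le> a'" "a' \<le> 2" "0 \<le> b" "b \<le> 2"
  shows "shifted \<Lambda> a b \<le> shifted \<Lambda> a' b"
proof -
  have sq: "a'\<^sup>2 \<le> 4" "a\<^sup>2 \<le> 4" "b\<^sup>2 \<le> 4" "b\<^sup>2 \<ge> 0"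
    using assms power_mono[of a' 2 2] power_mono[of a 2 2] power_mono[of b 2 2] by auto
  have "a' * a \<le> 2 * 2" using assms by (intro mult_mono) auto
  then have "(1 + \<Lambda>) / 4 * (a'\<^sup>2 + a' * a + a\<^sup>2) \<le> (1 + \<Lambda>) / 4 * 12"
    using assms sq by (intro mult_left_mono) auto
  then have X: "(1 + \<Lambda>) / 4 * (a'\<^sup>2 + a' * a + a\<^sup>2) \<le> 3 * (1 + \<Lambda>)" by simp
  have Y: "(\<Lambda> - 3) / 4 * b\<^sup>2 \<ge> -2"
  proof -
    have "(3 - \<Lambda>) / 4 * b\<^sup>2 \<le> (2 / 4) * b\<^sup>2" using assms sq by (intro mult_right_mono) auto
    then show ?thesis using sq by (simp add: algebra_simps)
  qed
  have "4 * (1 + \<Lambda>) + 1 - x + y \<ge> 0" if "x \<le> 3 * (1 + \<Lambda>)" "y \<ge> -2" for x y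
    using that assms(1) by (simp add: algebra_simps)
  from this[OF X Y]
  have "4 * (1 + \<Lambda>) + 1 - (1 + \<Lambda>) / 4 * (a'\<^sup>2 + a' * a + a\<^sup>2) + (\<Lambda> - 3) / 4 * b\<^sup>2 \<ge> 0" .
  then have "(a' - a) * (4 * (1 + \<Lambda>) + 1 - (1 + \<Lambda>) / 4 * (a'\<^sup>2 + a' * a + a\<^sup>2) + (\<Lambda> - 3) / 4 * b\<^sup>2) \<ge> 0"
    using assms by simp
  also have "(a' - a) * (4 * (1 + \<Lambda>) + 1 - (1 + \<Lambda>) / 4 * (a'\<^sup>2 + a' * a + a\<^sup>2) + (\<Lambda> - 3) / 4 * b\<^sup>2)
     = shifted \<Lambda> a' b - shifted \<Lambda> a b"
    unfolding shifted_def reaction_def by (simp add: field_simps power2_eq_square)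
  finally show ?thesis by simp
qed

text \<open>The coupling enters through \<open>(\<Lambda> - 3) / 4 * a * b^2\<close>, so the sign of \<open>\<Lambda> - 3\<close> decides whether
the system is cooperative or competitive in \<open>s\<close> and \<open>d\<close>.\<close>

lemma shifted_mono_right:
  assumes "0 \<le> a" "0 \<le> b" "0 \<le> b'" "(\<Lambda> - 3) * (b' - b) \<ge> 0"
  shows "shifted \<Lambda> a b \<le> shifted \<Lambda> a b'"
proof -
  have "a * (b' + b) / 4 * ((\<Lambda> - 3) * (b' - b)) \<ge> 0" using assms by simp
  also have "a * (b' + b) / 4 * ((\<Lambda> - 3) * (b' - b)) = shifted \<Lambda> a b' - shifted \<Lambda> a b"
    unfolding shifted_def reaction_def by (simp add: field_simps power2_eq_square)
  finally show ?thesis by simp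
qed

text \<open>Half of the difference of the two sides is the shifted nonlinearity of \<open>v\<close>, which is a
nonnegative multiple of \<open>v = (s - d) / 2\<close>. This is what keeps \<open>v\<close> nonnegative.\<close>

lemma shifted_swap:
  assumes "\<Lambda> > 1" "0 \<le> d" "d \<le> s" "s \<le> 2"
  shows "shifted \<Lambda> d s \<le> shifted \<Lambda> s d"
proof -
  define u v where "u = (s + d) / 2" and "v = (s - d) / 2"
  have "0 \<le> v" "v \<le> 1" "0 \<le> u" "u \<le> 2" using assms by (auto simp: u_def v_def)
  then have "v\<^sup>2 \<le> 1" "u\<^sup>2 \<le> 4" using power_mono[of v 1 2] power_mono[of u 2 2] by auto
  moreover have "\<Lambda> * u\<^sup>2 \<le> \<Lambda> * 4" using calculation assms by (intro mult_left_mono) auto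
  ultimately have "4 * (1 + \<Lambda>) + 1 - v\<^sup>2 - \<Lambda> * u\<^sup>2 \<ge> 0" by (smt (verit))
  then have "(s - d) * (4 * (1 + \<Lambda>) + 1 - v\<^sup>2 - \<Lambda> * u\<^sup>2) \<ge> 0" using assms by simp
  also have "(s - d) * (4 * (1 + \<Lambda>) + 1 - v\<^sup>2 - \<Lambda> * u\<^sup>2) = shifted \<Lambda> s d - shifted \<Lambda> d s"
    unfolding shifted_def reaction_def u_def v_def by (simp add: field_simps power2_eq_square)
  finally show ?thesis by simp
qed

lemma reaction_uv:
  fixes u v :: real
  shows "(reaction \<Lambda> (u + v) (u - v) + reaction \<Lambda> (u - v) (u + v)) / 2 = u - u ^ 3 - \<Lambda> * u * v\<^sup>2"
    and "(reaction \<Lambda> (u + v) (u - v) - reaction \<Lambda> (u - v) (u + v)) / 2 = v - v ^ 3 - \<Lambda> * u\<^sup>2 * v"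
  unfolding reaction_def by (simp_all add: field_simps power2_eq_square power3_eq_cube)

text \<open>The maximum principle for the difference of two functions. The factor \<open>c\<close> is only ever \<open>1\<close> or \<open>-1\<close>;
it allows the same statement to serve for an order that is reversed in one component.\<close>

lemma comparison:
  fixes K M c :: real
  assumes "M > 0" "K > 0" and J: "jet M w p q" and J': "jet M w' p' q'"
    and le: "\<And>x. x \<in> {0..M} \<Longrightarrow> c * (K * w x - q x) \<le> c * (K * w' x - q' x)"
    and l: "c * w 0 \<le> c * w' 0 \<or> p 0 = p' 0" and r: "c * w M \<le> c * w' M \<or> p M = p' M"
    and x: "x \<in> {0..M}"
  shows "c * w x \<le> c * w' x"
proof -
  have "c * (w' x - w x) \<ge> 0"
  proof (rule max_principle[OF assms(1,2) jet_cmult[OF jet_diff[OF J' J]] _ _ _ x])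
    show "c * (q' y - q y) \<le> K * (c * (w' y - w y))" if "y \<in> {0..M}" for y
      using le[OF that] by (simp add: algebra_simps)
    show "c * (w' 0 - w 0) \<ge> 0 \<or> c * (p' 0 - p 0) = 0" using l by (auto simp: algebra_simps)
    show "c * (w' M - w M) \<ge> 0 \<or> c * (p' M - p M) = 0" using r by (auto simp: algebra_simps)
  qed
  then show ?thesis by (simp add: algebra_simps)
qed

lemma shifted_bounds:
  assumes "\<Lambda> > 1" "0 \<le> a" "a \<le> 2" "0 \<le> b" "b \<le> 2"
  shows "0 \<le> shifted \<Lambda> a b" "shifted \<Lambda> a b \<le> 8 * (1 + \<Lambda>)"
proof -
  have "shifted \<Lambda> 0 b \<le> shifted \<Lambda> a b" by (rule shifted_mono_left) (use assms in auto)
  then show "0 \<le> shifted \<Lambda> a b" by (simp add: shifted_def reaction_def)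
  have b: "b\<^sup>2 \<le> 4" using assms power_mono[of b 2 2] by auto
  have "(\<Lambda> - 3) * b\<^sup>2 \<le> 4 * \<Lambda>"
  proof (cases "\<Lambda> \<ge> 3")
    case True
    then have "(\<Lambda> - 3) * b\<^sup>2 \<le> (\<Lambda> - 3) * 4" using b by (intro mult_left_mono) auto
    then show ?thesis by simp
  next
    case False
    then have "(\<Lambda> - 3) * b\<^sup>2 \<le> 0" by (intro mult_nonpos_nonneg) auto
    then show ?thesis using assms by simp
  qed
  then have "reaction \<Lambda> 2 b \<le> 0" by (simp add: reaction_def field_simps)
  moreover have "shifted \<Lambda> a b \<le> shifted \<Lambda> 2 b" by (rule shifted_mono_left) (use assms in auto)
  ultimately show "shifted \<Lambda> a b \<le> 8 * (1 + \<Lambda>)" by (simp add: shifted_def)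
qed

section \<open>Monotone iteration between barriers\<close>

text \<open>The half period \<open>M\<close> exceeds that of the linear oscillation of \<open>d\<close> about the equilibrium \<open>d = 0\<close>,
whose squared frequency is \<open>2 (\<Lambda> - 1) / (\<Lambda> + 1)\<close>. The excess leaves room for the cubic term of
a small sine of amplitude \<open>\<epsilon>\<close>.\<close>

locale barriers =
  fixes \<Lambda> M \<epsilon> :: real
  assumes \<Lambda>: "\<Lambda> > 1" and M: "M > 0"
    and \<epsilon>: "\<epsilon> > 0" "\<epsilon> \<le> 1" "\<epsilon> \<le> 2 / sqrt (1 + \<Lambda>)"
    and subcritical: "(pi / M)\<^sup>2 + (1 + \<Lambda>) / 4 * \<epsilon>\<^sup>2 \<le> 2 * (\<Lambda> - 1) / (\<Lambda> + 1)"
begin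

definition K where "K = 4 * (1 + \<Lambda>)"

text \<open>The value of \<open>u + v\<close> at the constant solution with \<open>u = v\<close>.\<close>

definition s0 where "s0 = 2 / sqrt (1 + \<Lambda>)"

text \<open>The orientation of the order in the component \<open>s\<close>. With respect to \<open>\<rho> s\<close> and \<open>d\<close> the system is
cooperative for every \<open>\<Lambda>\<close>, and \<open>\<rho> s0 \<le> \<rho>\<close>. The choice \<open>1\<close> at \<open>\<Lambda> = 3\<close> matters: with \<open>0\<close> the bounds
on \<open>\<rho> s\<close> would be void.\<close>

definition \<rho> :: real where "\<rho> = (if \<Lambda> \<ge> 3 then 1 else -1)"

text \<open>The lower barrier for \<open>d\<close>, a half wave on \<open>[0, M]\<close>.\<close>

definition d0 where "d0 x = \<epsilon> * sin (pi / M * x)"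

text \<open>The order interval from \<open>(s0, d0)\<close> to \<open>(1, 1)\<close>, whose upper end is the equilibrium \<open>u = 1, v = 0\<close>,
intersected with \<open>v \<ge> 0\<close>.\<close>

definition admissible where
  "admissible s d \<longleftrightarrow> continuous_on {0..M} s \<and> continuous_on {0..M} d \<and>
    (\<forall>x\<in>{0..M}. \<rho> * s0 \<le> \<rho> * s x \<and> \<rho> * s x \<le> \<rho> \<and> d0 x \<le> d x \<and> d x \<le> 1 \<and> d x \<le> s x)"

text \<open>The solutions sought are even in \<open>s\<close> and odd in \<open>d\<close> about both ends of the interval, hence Neumann
conditions for \<open>s\<close> and Dirichlet conditions for \<open>d\<close>. In these coordinates, though not in \<open>u\<close> and \<open>v\<close>,
the two boundary conditions decouple and both are compatible with the maximum principle.\<close>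

definition neumann_step where
  "neumann_step s d s' \<longleftrightarrow> (\<exists>p. jet M s' p (\<lambda>x. K * s' x - shifted \<Lambda> (s x) (d x)) \<and> p 0 = 0 \<and> p M = 0)"

definition dirichlet_step where
  "dirichlet_step s d d' \<longleftrightarrow>
     (\<exists>p. jet M d' p (\<lambda>x. K * d' x - shifted \<Lambda> (d x) (s x))) \<and> d' 0 = 0 \<and> d' M = 0"

lemma K_pos: "K > 0" using \<Lambda> by (simp add: K_def)

lemma s0_square: "s0\<^sup>2 = 4 / (1 + \<Lambda>)"
  using \<Lambda> by (simp add: s0_def power_divide)

lemma s0_sq: "(1 + \<Lambda>) * s0\<^sup>2 = 4"
proof -
  have "1 + \<Lambda> \<noteq> 0" using \<Lambda> by simp
  then show ?thesis unfolding s0_square by (metis nonzero_mult_div_cancel_left times_divide_eq_right)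
qed

lemma s0_bounds: "0 < s0" "s0 < 2" "\<rho> * s0 \<le> \<rho>"
proof -
  show "0 < s0" using \<Lambda> by (simp add: s0_def)
  note sq = s0_square
  have "s0\<^sup>2 < 2\<^sup>2" using \<Lambda> unfolding sq by (simp add: field_simps)
  then show "s0 < 2" by (rule power_less_imp_less_base) simp
  show "\<rho> * s0 \<le> \<rho>"
  proof (cases "\<Lambda> \<ge> 3")
    case True
    then have "s0\<^sup>2 \<le> 1\<^sup>2" unfolding sq by (simp add: field_simps)
    then have "s0 \<le> 1" by (rule power2_le_imp_le) simp
    then show ?thesis using True by (simp add: \<rho>_def)
  next
    case False
    then have "1\<^sup>2 \<le> s0\<^sup>2" unfolding sq using \<Lambda> by (simp add: field_simps)
    then have "1 \<le> s0" by (rule power2_le_imp_le) (use \<open>0 < s0\<close> in simp)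
    then show ?thesis using False by (simp add: \<rho>_def)
  qed
qed

lemma d0_bounds:
  assumes "x \<in> {0..M}"
  shows "0 \<le> d0 x" "d0 x \<le> \<epsilon>"
proof -
  have "0 \<le> pi / M * x" "pi / M * x \<le> pi" using assms M by (auto simp: field_simps)
  then have "0 \<le> sin (pi / M * x)" by (rule sin_ge_zero)
  then show "0 \<le> d0 x" using \<epsilon> by (simp add: d0_def)
  have "\<epsilon> * sin (pi / M * x) \<le> \<epsilon> * 1" using \<epsilon> by (intro mult_left_mono) auto
  then show "d0 x \<le> \<epsilon>" by (simp add: d0_def)
qed

lemma d0_pos:
  assumes "0 < x" "x < M"
  shows "d0 x > 0"
proof -
  have "0 < pi / M * x" "pi / M * x < pi" using assms M by (auto simp: field_simps)
  then have "0 < sin (pi / M * x)" by (rule sin_gt_zero)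
  then show ?thesis using \<epsilon> by (simp add: d0_def)
qed

lemma d0_ends: "d0 0 = 0" "d0 M = 0" using M by (auto simp: d0_def)

lemma d0_jet: "\<exists>p. jet M d0 p (\<lambda>x. - ((pi / M)\<^sup>2 * d0 x))"
  using jet_sin[of M \<epsilon> "pi / M"] unfolding d0_def[abs_def] by blast

lemma admissible_bounds:
  assumes "admissible s d" "x \<in> {0..M}"
  shows "min 1 s0 \<le> s x" "s x \<le> 2" "0 \<le> d x" "d x \<le> 1" "d x \<le> s x"
  using assms(1)[unfolded admissible_def] assms(2) s0_bounds d0_bounds[OF assms(2)]
  by (fastforce simp: \<rho>_def split: if_splits)+

lemma shifted_mono:
  assumes "0 \<le> s" "s \<le> 2" "0 \<le> s'" "s' \<le> 2" "0 \<le> d" "d \<le> d'" "d' \<le> 2" "\<rho> * s \<le> \<rho> * s'"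
  shows "\<rho> * shifted \<Lambda> s d \<le> \<rho> * shifted \<Lambda> s' d'" "shifted \<Lambda> d s \<le> shifted \<Lambda> d' s'"
proof -
  have "shifted \<Lambda> d s \<le> shifted \<Lambda> d' s" by (rule shifted_mono_left) (use \<Lambda> assms in auto)
  also have "\<dots> \<le> shifted \<Lambda> d' s'"
    by (rule shifted_mono_right) (use assms in \<open>auto simp: \<rho>_def mult_nonpos_nonpos split: if_splits\<close>)
  finally show "shifted \<Lambda> d s \<le> shifted \<Lambda> d' s'" .
  show "\<rho> * shifted \<Lambda> s d \<le> \<rho> * shifted \<Lambda> s' d'"
  proof (cases "\<Lambda> \<ge> 3")
    case True
    have "shifted \<Lambda> s d \<le> shifted \<Lambda> s' d"
      by (rule shifted_mono_left) (use \<Lambda> assms True in \<open>auto simp: \<rho>_def\<close>)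
    also have "\<dots> \<le> shifted \<Lambda> s' d'"
      by (rule shifted_mono_right) (use assms True in auto)
    finally show ?thesis using True by (simp add: \<rho>_def)
  next
    case False
    have "shifted \<Lambda> s' d' \<le> shifted \<Lambda> s d'"
      by (rule shifted_mono_left) (use \<Lambda> assms False in \<open>auto simp: \<rho>_def\<close>)
    also have "\<dots> \<le> shifted \<Lambda> s d"
      by (rule shifted_mono_right) (use assms False in \<open>auto simp: mult_nonpos_nonpos\<close>)
    finally show ?thesis using False by (simp add: \<rho>_def)
  qed
qed

text \<open>One step solves a linear problem whose right side is monotone in \<open>(\<rho> s, d)\<close> by \<open>shifted_mono\<close>, and
the linear problem itself preserves order by the maximum principle.\<close>

lemma step_preserves_order:
  assumes "admissible s d" "admissible t e"
    and le: "\<And>x. x \<in> {0..M} \<Longrightarrow> \<rho> * s x \<le> \<rho> * t x" "\<And>x. x \<in> {0..M} \<Longrightarrow> d x \<le> e x"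
    and n: "neumann_step s d s'" "neumann_step t e t'"
    and d: "dirichlet_step s d d'" "dirichlet_step t e e'"
    and x: "x \<in> {0..M}"
  shows "\<rho> * s' x \<le> \<rho> * t' x" "d' x \<le> e' x"
proof -
  have *: "\<rho> * shifted \<Lambda> (s y) (d y) \<le> \<rho> * shifted \<Lambda> (t y) (e y)"
    "shifted \<Lambda> (d y) (s y) \<le> shifted \<Lambda> (e y) (t y)" if y: "y \<in> {0..M}" for y
    using admissible_bounds[OF assms(1) y] admissible_bounds[OF assms(2) y] le[OF y] s0_bounds(1)
    by (auto intro!: shifted_mono)
  obtain p q where p: "jet M s' p (\<lambda>x. K * s' x - shifted \<Lambda> (s x) (d x))" "p 0 = 0" "p M = 0"
    and q: "jet M t' q (\<lambda>x. K * t' x - shifted \<Lambda> (t x) (e x))" "q 0 = 0" "q M = 0"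
    using n by (auto simp: neumann_step_def)
  show "\<rho> * s' x \<le> \<rho> * t' x"
    by (rule comparison[OF M K_pos p(1) q(1) _ _ _ x]) (use p q * in auto)
  obtain p q where p: "jet M d' p (\<lambda>x. K * d' x - shifted \<Lambda> (d x) (s x))"
    and q: "jet M e' q (\<lambda>x. K * e' x - shifted \<Lambda> (e x) (t x))"
    using d by (auto simp: dirichlet_step_def)
  have "1 * d' x \<le> 1 * e' x"
    by (rule comparison[OF M K_pos p(1) q(1) _ _ _ x]) (use d * in \<open>auto simp: dirichlet_step_def\<close>)
  then show "d' x \<le> e' x" by simp
qed

text \<open>The subsolution property of the lower barrier: as \<open>d0'' = - (pi / M)^2 d0\<close>, the margin in
\<open>subcritical\<close> absorbs the cubic term.\<close>

lemma shifted_d0: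
  assumes "x \<in> {0..M}"
  shows "(K + (pi / M)\<^sup>2) * d0 x \<le> shifted \<Lambda> (d0 x) s0"
proof -
  note d = d0_bounds[OF assms]
  have "(d0 x)\<^sup>2 \<le> \<epsilon>\<^sup>2" using d by (intro power_mono) auto
  then have "(1 + \<Lambda>) / 4 * (d0 x)\<^sup>2 \<le> (1 + \<Lambda>) / 4 * \<epsilon>\<^sup>2" using \<Lambda> by (intro mult_left_mono) auto
  moreover have "1 + (\<Lambda> - 3) / 4 * s0\<^sup>2 = 2 * (\<Lambda> - 1) / (\<Lambda> + 1)"
  proof -
    note sq = s0_square
    show ?thesis unfolding sq using \<Lambda> by (simp add: field_simps)
  qed
  ultimately have "K + (pi / M)\<^sup>2 \<le> K + (1 - (1 + \<Lambda>) / 4 * (d0 x)\<^sup>2 + (\<Lambda> - 3) / 4 * s0\<^sup>2)"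
    using subcritical by linarith
  then have "(K + (pi / M)\<^sup>2) * d0 x \<le> (K + (1 - (1 + \<Lambda>) / 4 * (d0 x)\<^sup>2 + (\<Lambda> - 3) / 4 * s0\<^sup>2)) * d0 x"
    using d by (intro mult_right_mono)
  also have "\<dots> = shifted \<Lambda> (d0 x) s0"
    unfolding shifted_def reaction_def K_def by (simp only: algebra_simps)
  finally show ?thesis .
qed

text \<open>Every bound comes from comparing a new iterate with a barrier, or \<open>d'\<close> with \<open>s'\<close>. The pairs
\<open>(s0, 0)\<close> and \<open>(1, 1)\<close> are equilibria, which settles the constant bounds; \<open>d0\<close> is a
subsolution; and \<open>d \<le> s\<close> is inherited by \<open>shifted_swap\<close>.\<close>

lemma step_admissible:
  assumes a: "admissible s d" and n: "neumann_step s d s'" and d: "dirichlet_step s d d'"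
  shows "admissible s' d'"
proof -
  obtain p where p: "jet M s' p (\<lambda>x. K * s' x - shifted \<Lambda> (s x) (d x))" "p 0 = 0" "p M = 0"
    using n by (auto simp: neumann_step_def)
  obtain q where q: "jet M d' q (\<lambda>x. K * d' x - shifted \<Lambda> (d x) (s x))"
    using d by (auto simp: dirichlet_step_def)
  have ends: "d' 0 = 0" "d' M = 0" using d by (auto simp: dirichlet_step_def)
  obtain r where r: "jet M d0 r (\<lambda>x. - ((pi / M)\<^sup>2 * d0 x))" using d0_jet by blast
  have ord: "\<rho> * s0 \<le> \<rho> * s y" "\<rho> * s y \<le> \<rho>" "d0 y \<le> d y" if "y \<in> {0..M}" for y
    using a that by (auto simp: admissible_def)
  note b = admissible_bounds[OF a]
  have s_pos: "0 \<le> s y" if "y \<in> {0..M}" for y using b[OF that] by auto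
  have lower_s: "\<rho> * s0 \<le> \<rho> * s' x" if x: "x \<in> {0..M}" for x
  proof (rule comparison[OF M K_pos jet_const[of M s0] p(1) _ _ _ x])
    fix y assume y: "y \<in> {0..M}"
    have "\<rho> * shifted \<Lambda> s0 0 \<le> \<rho> * shifted \<Lambda> (s y) (d y)"
      using b[OF y] s_pos[OF y] ord[OF y] s0_bounds by (intro shifted_mono) auto
    moreover have "shifted \<Lambda> s0 0 = K * s0"
      using s0_sq by (simp add: shifted_def reaction_def K_def field_simps)
    ultimately show "\<rho> * (K * s0 - 0) \<le> \<rho> * (K * s' y - (K * s' y - shifted \<Lambda> (s y) (d y)))" by simp
  qed (use p in auto)
  have sh11: "shifted \<Lambda> 1 1 = K" by (simp add: shifted_def reaction_def K_def field_simps)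
  have upper_s: "\<rho> * s' x \<le> \<rho> * 1" if x: "x \<in> {0..M}" for x
  proof (rule comparison[OF M K_pos p(1) jet_const[of M 1] _ _ _ x])
    fix y assume y: "y \<in> {0..M}"
    have "\<rho> * shifted \<Lambda> (s y) (d y) \<le> \<rho> * shifted \<Lambda> 1 1"
      using b[OF y] s_pos[OF y] ord[OF y] by (intro shifted_mono) auto
    then show "\<rho> * (K * s' y - (K * s' y - shifted \<Lambda> (s y) (d y))) \<le> \<rho> * (K * 1 - 0)"
      by (simp add: sh11)
  qed (use p in auto)
  have upper_d: "1 * d' x \<le> 1 * 1" if x: "x \<in> {0..M}" for x
  proof (rule comparison[OF M K_pos q jet_const[of M 1] _ _ _ x])
    fix y assume y: "y \<in> {0..M}"
    have "shifted \<Lambda> (d y) (s y) \<le> shifted \<Lambda> 1 1"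
      using b[OF y] s_pos[OF y] ord[OF y] by (intro shifted_mono) auto
    then show "1 * (K * d' y - (K * d' y - shifted \<Lambda> (d y) (s y))) \<le> 1 * (K * 1 - 0)"
      by (simp add: sh11)
  qed (use ends in auto)
  have lower_d: "1 * d0 x \<le> 1 * d' x" if x: "x \<in> {0..M}" for x
  proof (rule comparison[OF M K_pos r q _ _ _ x])
    fix y assume y: "y \<in> {0..M}"
    have "shifted \<Lambda> (d0 y) s0 \<le> shifted \<Lambda> (d y) (s y)"
      using b[OF y] s_pos[OF y] ord[OF y] s0_bounds d0_bounds[OF y] by (intro shifted_mono) auto
    then show "1 * (K * d0 y - - ((pi / M)\<^sup>2 * d0 y)) \<le> 1 * (K * d' y - (K * d' y - shifted \<Lambda> (d y) (s y)))"
      using shifted_d0[OF y] by (simp add: algebra_simps)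
  qed (use ends d0_ends in auto)
  have s'_pos: "0 \<le> s' x" if "x \<in> {0..M}" for x
    using lower_s[OF that] upper_s[OF that] s0_bounds by (auto simp: \<rho>_def split: if_splits)
  have d_le_s: "1 * d' x \<le> 1 * s' x" if x: "x \<in> {0..M}" for x
  proof (rule comparison[OF M K_pos q p(1) _ _ _ x])
    fix y assume y: "y \<in> {0..M}"
    have "shifted \<Lambda> (d y) (s y) \<le> shifted \<Lambda> (s y) (d y)"
      using b[OF y] \<Lambda> by (intro shifted_swap) auto
    then show "1 * (K * d' y - (K * d' y - shifted \<Lambda> (d y) (s y))) \<le> 1 * (K * s' y - (K * s' y - shifted \<Lambda> (s y) (d y)))"
      by simp
  qed (use ends s'_pos M in auto)
  show ?thesis
    unfolding admissible_def
    using lower_s upper_s lower_d upper_d d_le_s jet_continuous[OF p(1)] jet_continuous[OF q]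
    by auto
qed

lemma start_admissible: "admissible (\<lambda>_. s0) d0"
proof -
  have "continuous_on {0..M} d0" using d0_jet jet_continuous by blast
  moreover have "d0 x \<le> s0" "d0 x \<le> 1" if "x \<in> {0..M}" for x
    using d0_bounds[OF that] \<epsilon> by (auto simp: s0_def)
  ultimately show ?thesis using s0_bounds by (auto simp: admissible_def)
qed

lemma step_exists:
  assumes "admissible s d"
  shows "\<exists>s'. neumann_step s d s'" "\<exists>d'. dirichlet_step s d d'"
proof -
  have c: "continuous_on {0..M} s" "continuous_on {0..M} d" using assms by (auto simp: admissible_def)
  have k: "sqrt K > 0" "(sqrt K)\<^sup>2 = K" using K_pos by auto
  have "continuous_on {0..M} (\<lambda>x. shifted \<Lambda> (s x) (d x))"
    unfolding shifted_def reaction_def by (intro continuous_intros c)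
  from neumann_problem[OF k(1) M this] show "\<exists>s'. neumann_step s d s'"
    unfolding neumann_step_def k(2) by metis
  have "continuous_on {0..M} (\<lambda>x. shifted \<Lambda> (d x) (s x))"
    unfolding shifted_def reaction_def by (intro continuous_intros c)
  from dirichlet_problem[OF k(1) M this] show "\<exists>d'. dirichlet_step s d d'"
    unfolding dirichlet_step_def k(2) by metis
qed

text \<open>The start \<open>(s0, d0)\<close> is the least admissible pair, so the first step goes up, and by
\<open>step_preserves_order\<close> so do all others.\<close>

lemma monotone_sequence:
  obtains s d where "\<And>n. admissible (s n) (d n)"
    and "\<And>n. neumann_step (s n) (d n) (s (Suc n))" and "\<And>n. dirichlet_step (s n) (d n) (d (Suc n))"
    and "\<And>n x. x \<in> {0..M} \<Longrightarrow> \<rho> * s n x \<le> \<rho> * s (Suc n) x"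
    and "\<And>n x. x \<in> {0..M} \<Longrightarrow> d n x \<le> d (Suc n) x"
proof -
  have "\<exists>f. \<forall>n. (admissible (fst (f n)) (snd (f n)) \<and> (n = 0 \<longrightarrow> f n = (\<lambda>_. s0, d0))) \<and>
      (neumann_step (fst (f n)) (snd (f n)) (fst (f (Suc n))) \<and>
       dirichlet_step (fst (f n)) (snd (f n)) (snd (f (Suc n))))"
  proof (rule dependent_nat_choice)
    show "\<exists>z. admissible (fst z) (snd z) \<and> (0 = (0::nat) \<longrightarrow> z = (\<lambda>_. s0, d0))"
      using start_admissible by (intro exI[of _ "(\<lambda>_. s0, d0)"]) auto
  next
    fix z and n :: nat
    assume "admissible (fst z) (snd z) \<and> (n = 0 \<longrightarrow> z = (\<lambda>_. s0, d0))"
    then have a: "admissible (fst z) (snd z)" by simp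
    obtain s' d' where "neumann_step (fst z) (snd z) s'" "dirichlet_step (fst z) (snd z) d'"
      using step_exists[OF a] by blast
    then show "\<exists>z'. (admissible (fst z') (snd z') \<and> (Suc n = 0 \<longrightarrow> z' = (\<lambda>_. s0, d0))) \<and>
       (neumann_step (fst z) (snd z) (fst z') \<and> dirichlet_step (fst z) (snd z) (snd z'))"
      using step_admissible[OF a] by (intro exI[of _ "(s', d')"]) auto
  qed
  then obtain f where f: "\<And>n. admissible (fst (f n)) (snd (f n))" "f 0 = (\<lambda>_. s0, d0)"
      "\<And>n. neumann_step (fst (f n)) (snd (f n)) (fst (f (Suc n)))"
      "\<And>n. dirichlet_step (fst (f n)) (snd (f n)) (snd (f (Suc n)))"
    by blast
  have "\<forall>x\<in>{0..M}. \<rho> * fst (f n) x \<le> \<rho> * fst (f (Suc n)) x \<and> snd (f n) x \<le> snd (f (Suc n)) x" for n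
  proof (induction n)
    case 0
    then show ?case using f(1)[of "Suc 0"] by (auto simp: f(2) admissible_def)
  next
    case (Suc n)
    then show ?case
      using step_preserves_order[OF f(1) f(1) _ _ f(3) f(3) f(4) f(4), of n "Suc n"] by blast
  qed
  then show ?thesis using f by (intro that[of "\<lambda>n. fst (f n)" "\<lambda>n. snd (f n)"]) auto
qed

lemma half_period_solution:
  obtains S P D R where
    "jet M S P (\<lambda>x. - reaction \<Lambda> (S x) (D x))" "P 0 = 0" "P M = 0"
    "jet M D R (\<lambda>x. - reaction \<Lambda> (D x) (S x))" "D 0 = 0" "D M = 0"
    "admissible S D"
proof -
  obtain s d where a: "\<And>n. admissible (s n) (d n)"
    and N: "\<And>n. neumann_step (s n) (d n) (s (Suc n))"
    and Di: "\<And>n. dirichlet_step (s n) (d n) (d (Suc n))"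
    and inc: "\<And>n x. x \<in> {0..M} \<Longrightarrow> \<rho> * s n x \<le> \<rho> * s (Suc n) x"
      "\<And>n x. x \<in> {0..M} \<Longrightarrow> d n x \<le> d (Suc n) x"
    using monotone_sequence by blast
  note b = admissible_bounds[OF a]
  have s_pos: "0 \<le> s n x" if "x \<in> {0..M}" for n x using b(1)[OF that, of n] s0_bounds by auto
  have "\<exists>l. (\<lambda>n. s n x) \<longlonglongrightarrow> l" if x: "x \<in> {0..M}" for x
  proof -
    have "\<forall>n. \<rho> * s n x \<le> \<rho>" using a x by (auto simp: admissible_def)
    moreover have "incseq (\<lambda>n. \<rho> * s n x)" using inc(1)[OF x] by (intro incseq_SucI)
    ultimately obtain l where "(\<lambda>n. \<rho> * s n x) \<longlonglongrightarrow> l" using incseq_convergent by blast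
    then have "(\<lambda>n. \<rho> * (\<rho> * s n x)) \<longlonglongrightarrow> \<rho> * l" by (intro tendsto_intros)
    moreover have "\<rho> * (\<rho> * y) = y" for y by (auto simp: \<rho>_def)
    ultimately show ?thesis by auto
  qed
  then obtain S where S: "\<And>x. x \<in> {0..M} \<Longrightarrow> (\<lambda>n. s n x) \<longlonglongrightarrow> S x" by metis
  have "\<exists>l. (\<lambda>n. d n x) \<longlonglongrightarrow> l" if x: "x \<in> {0..M}" for x
  proof -
    have "incseq (\<lambda>n. d n x)" using inc(2)[OF x] by (intro incseq_SucI)
    then show ?thesis using incseq_convergent[of "\<lambda>n. d n x" 1] b(4)[OF x] by blast
  qed
  then obtain D where D: "\<And>x. x \<in> {0..M} \<Longrightarrow> (\<lambda>n. d n x) \<longlonglongrightarrow> D x" by metis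
  obtain p where p: "\<And>n. jet M (s (Suc n)) (p n) (\<lambda>x. K * s (Suc n) x - shifted \<Lambda> (s n x) (d n x))"
      "\<And>n. p n 0 = 0" "\<And>n. p n M = 0"
    using N unfolding neumann_step_def by metis
  obtain r where r: "\<And>n. jet M (d (Suc n)) (r n) (\<lambda>x. K * d (Suc n) x - shifted \<Lambda> (d n x) (s n x))"
    and ends: "\<And>n. d (Suc n) 0 = 0" "\<And>n. d (Suc n) M = 0"
    using Di unfolding dirichlet_step_def by metis
  have Kb: "0 \<le> K * y" "K * y \<le> 2 * K" if "0 \<le> y" "y \<le> 2" for y
    using that K_pos by (auto simp: mult.commute[of 2])
  have bs: "\<bar>K * s (Suc n) x - shifted \<Lambda> (s n x) (d n x)\<bar> \<le> 2 * K"
    and bd: "\<bar>K * d (Suc n) x - shifted \<Lambda> (d n x) (s n x)\<bar> \<le> 2 * K" if x: "x \<in> {0..M}" for n x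
  proof -
    have bn: "s n x \<le> 2" "0 \<le> s n x" "0 \<le> d n x" "d n x \<le> 2" for n
      using b[OF x, of n] s_pos[OF x, of n] by auto
    show "\<bar>K * s (Suc n) x - shifted \<Lambda> (s n x) (d n x)\<bar> \<le> 2 * K"
    proof -
      have "0 \<le> shifted \<Lambda> (s n x) (d n x)" "shifted \<Lambda> (s n x) (d n x) \<le> 2 * K"
        using shifted_bounds[OF \<Lambda> bn(2,1,3,4), of n n] by (auto simp: K_def)
      moreover have "0 \<le> K * s (Suc n) x" "K * s (Suc n) x \<le> 2 * K"
        using Kb bn by auto
      ultimately show ?thesis by linarith
    qed
    show "\<bar>K * d (Suc n) x - shifted \<Lambda> (d n x) (s n x)\<bar> \<le> 2 * K"
    proof -
      have "0 \<le> shifted \<Lambda> (d n x) (s n x)" "shifted \<Lambda> (d n x) (s n x) \<le> 2 * K"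
        using shifted_bounds[OF \<Lambda> bn(3,4,2,1), of n n] by (auto simp: K_def)
      moreover have "0 \<le> K * d (Suc n) x" "K * d (Suc n) x \<le> 2 * K"
        using Kb bn by auto
      ultimately show ?thesis by linarith
    qed
  qed
  have S': "(\<lambda>n. s (Suc n) x) \<longlonglongrightarrow> S x" and D': "(\<lambda>n. d (Suc n) x) \<longlonglongrightarrow> D x"
    if "x \<in> {0..M}" for x
    using LIMSEQ_Suc[OF S[OF that]] LIMSEQ_Suc[OF D[OF that]] by auto
  have qs: "(\<lambda>n. K * s (Suc n) x - shifted \<Lambda> (s n x) (d n x)) \<longlonglongrightarrow> - reaction \<Lambda> (S x) (D x)"
    if "x \<in> {0..M}" for x
  proof -
    have "(\<lambda>n. K * s (Suc n) x - shifted \<Lambda> (s n x) (d n x)) \<longlonglongrightarrow> K * S x - shifted \<Lambda> (S x) (D x)"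
      unfolding shifted_def reaction_def by (intro tendsto_intros S S' D that)
    then show ?thesis by (simp add: shifted_def K_def)
  qed
  have qd: "(\<lambda>n. K * d (Suc n) x - shifted \<Lambda> (d n x) (s n x)) \<longlonglongrightarrow> - reaction \<Lambda> (D x) (S x)"
    if "x \<in> {0..M}" for x
  proof -
    have "(\<lambda>n. K * d (Suc n) x - shifted \<Lambda> (d n x) (s n x)) \<longlonglongrightarrow> K * D x - shifted \<Lambda> (D x) (S x)"
      unfolding shifted_def reaction_def by (intro tendsto_intros S D' D that)
    then show ?thesis by (simp add: shifted_def K_def)
  qed
  obtain P where P: "continuous_on {0..M} S"
      "continuous_on {0..M} (\<lambda>x. - reaction \<Lambda> (S x) (D x)) \<Longrightarrow> jet M S P (\<lambda>x. - reaction \<Lambda> (S x) (D x))"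
      "(\<lambda>n. p n 0) \<longlonglongrightarrow> P 0" "(\<lambda>n. p n M) \<longlonglongrightarrow> P M"
    using jet_limit[OF M p(1) bs S' qs] by blast
  obtain R where R: "continuous_on {0..M} D"
      "continuous_on {0..M} (\<lambda>x. - reaction \<Lambda> (D x) (S x)) \<Longrightarrow> jet M D R (\<lambda>x. - reaction \<Lambda> (D x) (S x))"
    using jet_limit[OF M r(1) bd D' qd] by blast
  show ?thesis
  proof (rule that[of S P D R])
    show "jet M S P (\<lambda>x. - reaction \<Lambda> (S x) (D x))" "jet M D R (\<lambda>x. - reaction \<Lambda> (D x) (S x))"
      unfolding reaction_def
      by (rule P(2)[unfolded reaction_def] R(2)[unfolded reaction_def]; intro continuous_intros P(1) R(1))+
    show "P 0 = 0" "P M = 0" using P(3,4) p(2,3) by (auto simp: LIMSEQ_const_iff)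
    have "0 \<in> {0..M}" "M \<in> {0..M}" using M by auto
    then show "D 0 = 0" "D M = 0" using D'[of 0] D'[of M] ends by (auto simp: LIMSEQ_const_iff)
    have "\<rho> * s0 \<le> \<rho> * S x \<and> \<rho> * S x \<le> \<rho> \<and> d0 x \<le> D x \<and> D x \<le> 1 \<and> D x \<le> S x"
      if x: "x \<in> {0..M}" for x
    proof (intro conjI)
      have A: "\<forall>n. \<rho> * s0 \<le> \<rho> * s n x \<and> \<rho> * s n x \<le> \<rho> \<and> d0 x \<le> d n x \<and> d n x \<le> 1 \<and> d n x \<le> s n x"
        using a x by (auto simp: admissible_def)
      have rS: "(\<lambda>n. \<rho> * s n x) \<longlonglongrightarrow> \<rho> * S x" by (intro tendsto_intros S x)
      show "\<rho> * s0 \<le> \<rho> * S x" by (rule LIMSEQ_le_const[OF rS]) (use A in auto)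
      show "\<rho> * S x \<le> \<rho>" by (rule LIMSEQ_le_const2[OF rS]) (use A in auto)
      show "d0 x \<le> D x" by (rule LIMSEQ_le_const[OF D[OF x]]) (use A in auto)
      show "D x \<le> 1" by (rule LIMSEQ_le_const2[OF D[OF x]]) (use A in auto)
      show "D x \<le> S x" by (rule LIMSEQ_le[OF D[OF x] S[OF x]]) (use A in auto)
    qed
    then show "admissible S D" using P(1) R(1) by (auto simp: admissible_def)
  qed
qed

text \<open>The iteration gives only \<open>v \<ge> 0\<close>. The convex function \<open>\<eta> exp (k x)\<close> with \<open>k^2 = K\<close> solves
\<open>w'' = K w\<close> and lies below \<open>s - d\<close> at both ends for small \<open>\<eta>\<close>, hence throughout.\<close>

lemma difference_below_sum:
  assumes S: "jet M S P (\<lambda>x. - reaction \<Lambda> (S x) (D x))"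
    and D: "jet M D R (\<lambda>x. - reaction \<Lambda> (D x) (S x))" and ends: "D 0 = 0" "D M = 0"
    and a: "admissible S D" and x: "x \<in> {0..M}"
  shows "D x < S x"
proof -
  define k where "k = sqrt K"
  \<comment> \<open>\<eta> exp (k x) takes the value min 1 s0, a lower bound of S, at x = M\<close>
  define \<eta> where "\<eta> = min 1 s0 * exp (- k * M)"
  have k: "k > 0" "k\<^sup>2 = K" using K_pos by (auto simp: k_def)
  have m: "min 1 s0 > 0" using s0_bounds by auto
  then have \<eta>: "\<eta> > 0" by (simp add: \<eta>_def)
  have "exp (- k * M) \<le> 1" using k M by simp
  then have "\<eta> \<le> min 1 s0" unfolding \<eta>_def using m by (intro mult_left_le) auto
  have "1 * (\<eta> * exp (k * x)) \<le> 1 * (S x - D x)"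
  proof (rule comparison[OF M K_pos jet_exp[of M \<eta> k] jet_diff[OF S D] _ _ _ x])
    fix y assume y: "y \<in> {0..M}"
    have "shifted \<Lambda> (D y) (S y) \<le> shifted \<Lambda> (S y) (D y)"
      using admissible_bounds[OF a y] \<Lambda> by (intro shifted_swap) auto
    then show "1 * (K * (\<eta> * exp (k * y)) - k\<^sup>2 * (\<eta> * exp (k * y)))
        \<le> 1 * (K * (S y - D y) - (- reaction \<Lambda> (S y) (D y) - - reaction \<Lambda> (D y) (S y)))"
      by (simp add: k shifted_def K_def algebra_simps)
  next
    have "min 1 s0 \<le> S 0" "min 1 s0 \<le> S M" using admissible_bounds(1)[OF a] M by auto
    moreover have "\<eta> * exp (k * M) = min 1 s0" by (simp add: \<eta>_def exp_minus)
    ultimately show "1 * (\<eta> * exp (k * 0)) \<le> 1 * (S 0 - D 0) \<or> \<eta> * (k * exp (k * 0)) = P 0 - R 0"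
      "1 * (\<eta> * exp (k * M)) \<le> 1 * (S M - D M) \<or> \<eta> * (k * exp (k * M)) = P M - R M"
      using ends \<open>\<eta> \<le> min 1 s0\<close> by auto
  qed
  moreover have "\<eta> * exp (k * x) > 0" using \<eta> by simp
  ultimately show ?thesis by simp
qed

end

section \<open>Periodic extension by reflection\<close>

text \<open>The extension from \<open>[0, M]\<close> to the line by reflection at all multiples of \<open>M\<close>: even reflection for
\<open>\<sigma> = 1\<close>, odd reflection for \<open>\<sigma> = -1\<close>.\<close>

definition reflect :: "real \<Rightarrow> real \<Rightarrow> (real \<Rightarrow> real) \<Rightarrow> real \<Rightarrow> real" where
  "reflect \<sigma> M f x = (let n = \<lfloor>x / M\<rfloor> in
     if even n then f (x - of_int n * M) else \<sigma> * f (of_int (n + 1) * M - x))"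

text \<open>The hypotheses on \<open>f\<close> say that its end values agree with their reflections; then the formula of a
cell holds also at its right end, where \<open>reflect\<close> already uses the next cell.\<close>

lemma reflect_on_cell:
  assumes "M > 0" and f: "f 0 = \<sigma> * f 0" "f M = \<sigma> * f M"
    and x: "x \<in> {of_int n * M..of_int (n + 1) * M}"
  shows "reflect \<sigma> M f x =
    (if even n then f (x - of_int n * M) else \<sigma> * f (of_int (n + 1) * M - x))"
proof (cases "x = of_int (n + 1) * M")
  case True
  then have "x / M = of_int (n + 1)" using \<open>M > 0\<close> by simp
  then have "\<lfloor>x / M\<rfloor> = n + 1" by (simp only: floor_of_int)
  then show ?thesis using True f by (auto simp: reflect_def Let_def algebra_simps)
next
  case False
  then have "of_int n \<le> x / M" "x / M < of_int n + 1"
    using x \<open>M > 0\<close> by (auto simp: field_simps)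
  then have "\<lfloor>x / M\<rfloor> = n" by (rule floor_unique)
  then show ?thesis by (simp add: reflect_def Let_def)
qed

lemma reflect_cases:
  assumes "M > 0"
  obtains y where "y \<in> {0..M}" "\<And>f \<sigma>. reflect \<sigma> M f x = f y"
  | y where "y \<in> {0..M}" "\<And>f \<sigma>. reflect \<sigma> M f x = \<sigma> * f y"
proof -
  define n where "n = \<lfloor>x / M\<rfloor>"
  have "of_int n \<le> x / M" "x / M \<le> of_int n + 1" unfolding n_def by linarith+
  then have "of_int n * M \<le> x" "x \<le> of_int (n + 1) * M" using assms by (auto simp: field_simps)
  then have "x - of_int n * M \<in> {0..M}" "of_int (n + 1) * M - x \<in> {0..M}"
    by (auto simp: algebra_simps)
  then show ?thesis
    using that(1)[of "x - of_int n * M"] that(2)[of "of_int (n + 1) * M - x"]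
    by (cases "even n") (auto simp: reflect_def n_def[symmetric] Let_def)
qed

text \<open>Reflection changes parity under differentiation. On each closed cell this is the chain rule; at a
multiple of \<open>M\<close> the derivatives of the two adjacent cells agree and combine.\<close>

lemma reflect_deriv:
  assumes M: "M > 0"
    and d: "\<And>x. x \<in> {0..M} \<Longrightarrow> (f has_real_derivative f' x) (at x within {0..M})"
    and f: "f 0 = \<sigma> * f 0" "f M = \<sigma> * f M"
    and f': "f' 0 = - \<sigma> * f' 0" "f' M = - \<sigma> * f' M"
  shows "(reflect \<sigma> M f has_real_derivative reflect (- \<sigma>) M f' x) (at x)"
proof -
  define I where "I n = {of_int n * M..of_int (n + 1) * M}" for n :: int
  have cell: "(reflect \<sigma> M f has_real_derivative reflect (- \<sigma>) M f' x) (at x within I n)"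
    if x: "x \<in> I n" for x n
  proof (cases "even n")
    case True
    have "x - of_int n * M \<in> {0..M}" using x by (auto simp: I_def algebra_simps)
    then have 1: "(f has_real_derivative f' (x - of_int n * M)) (at (x - of_int n * M) within {0..M})"
      by (rule d)
    have "(\<lambda>t. t - of_int n * M) ` I n \<subseteq> {0..M}" by (auto simp: I_def algebra_simps)
    from has_field_derivative_subset[OF 1 this]
    have "((\<lambda>t. f (t - of_int n * M)) has_real_derivative f' (x - of_int n * M) * 1) (at x within I n)"
      by (rule DERIV_image_chain[unfolded o_def]) (auto intro!: derivative_eq_intros)
    then have "((\<lambda>t. f (t - of_int n * M)) has_real_derivative reflect (- \<sigma>) M f' x) (at x within I n)"
      using reflect_on_cell[OF M f'[unfolded minus_mult_left], of x n] x True by (simp add: I_def)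
    then show ?thesis
      by (rule has_field_derivative_transform_within[OF _ zero_less_one x])
        (use reflect_on_cell[OF M f, of _ n] True in \<open>simp add: I_def\<close>)
  next
    case False
    have "of_int (n + 1) * M - x \<in> {0..M}" using x by (auto simp: I_def algebra_simps)
    then have 1: "(f has_real_derivative f' (of_int (n + 1) * M - x)) (at (of_int (n + 1) * M - x) within {0..M})"
      by (rule d)
    have "(\<lambda>t. of_int (n + 1) * M - t) ` I n \<subseteq> {0..M}" by (auto simp: I_def algebra_simps)
    from has_field_derivative_subset[OF 1 this]
    have "((\<lambda>t. f (of_int (n + 1) * M - t)) has_real_derivative f' (of_int (n + 1) * M - x) * (-1)) (at x within I n)"
      by (rule DERIV_image_chain[unfolded o_def]) (auto intro!: derivative_eq_intros)
    then have "((\<lambda>t. \<sigma> * f (of_int (n + 1) * M - t)) has_real_derivative \<sigma> * (f' (of_int (n + 1) * M - x) * (-1))) (at x within I n)"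
      by (rule DERIV_cmult)
    then have "((\<lambda>t. \<sigma> * f (of_int (n + 1) * M - t)) has_real_derivative reflect (- \<sigma>) M f' x) (at x within I n)"
      using reflect_on_cell[OF M f', of x n] x False by (simp add: I_def)
    then show ?thesis
      by (rule has_field_derivative_transform_within[OF _ zero_less_one x])
        (use reflect_on_cell[OF M f, of _ n] False in \<open>simp add: I_def\<close>)
  qed
  define n where "n = \<lfloor>x / M\<rfloor>"
  have "of_int n \<le> x / M" "x / M < of_int n + 1" unfolding n_def by linarith+
  then have n: "of_int n * M \<le> x" "x < of_int (n + 1) * M" using M by (auto simp: field_simps)
  show ?thesis
  proof (cases "x = of_int n * M")
    case True
    have "x \<in> I n" "x \<in> I (n - 1)" using True M by (auto simp: I_def algebra_simps)
    then have "(reflect \<sigma> M f has_real_derivative reflect (- \<sigma>) M f' x) (at x within I (n - 1) \<union> I n)"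
      using cell unfolding has_field_derivative_iff Lim_within_Un by blast
    moreover have "I (n - 1) \<union> I n = {x - M..x + M}" using True M by (auto simp: I_def algebra_simps)
    ultimately show ?thesis using M by (simp add: at_within_Icc_at)
  next
    case False
    then have "at x within I n = at x" using n unfolding I_def by (intro at_within_Icc_at) auto
    moreover have "x \<in> I n" using n by (auto simp: I_def)
    ultimately show ?thesis using cell[of x n] by simp
  qed
qed

text \<open>Reflecting \<open>s\<close> evenly and \<open>d\<close> oddly respects the equations because \<open>reaction\<close> is even in its second
and odd in its first argument. The zeros of \<open>d\<close> are then exactly the multiples of \<open>M\<close>.\<close>

lemma (in barriers) periodic_profile:
  obtains S S1 D D1 :: "real \<Rightarrow> real" where
    "\<And>x. (S has_real_derivative S1 x) (at x)"
    "\<And>x. (S1 has_real_derivative - reaction \<Lambda> (S x) (D x)) (at x)"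
    "\<And>x. (D has_real_derivative D1 x) (at x)"
    "\<And>x. (D1 has_real_derivative - reaction \<Lambda> (D x) (S x)) (at x)"
    "\<And>x. \<bar>D x\<bar> < S x" "\<And>x. 0 < x \<Longrightarrow> x < M \<Longrightarrow> D x > 0" "\<And>n. D (of_int n * M) = 0"
proof -
  obtain S P D R where
    S: "jet M S P (\<lambda>x. - reaction \<Lambda> (S x) (D x))" "P 0 = 0" "P M = 0"
    and D: "jet M D R (\<lambda>x. - reaction \<Lambda> (D x) (S x))" "D 0 = 0" "D M = 0"
    and a: "admissible S D" by (rule half_period_solution)
  define S' where "S' = reflect 1 M S"
  define D' where "D' = reflect (-1) M D"
  have r: "- reaction \<Lambda> (S' x) (D' x) = reflect 1 M (\<lambda>x. - reaction \<Lambda> (S x) (D x)) x"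
    "- reaction \<Lambda> (D' x) (S' x) = reflect (-1) M (\<lambda>x. - reaction \<Lambda> (D x) (S x)) x" for x
  proof -
    have "- reaction \<Lambda> (S' x) (D' x) = reflect 1 M (\<lambda>x. - reaction \<Lambda> (S x) (D x)) x \<and>
      - reaction \<Lambda> (D' x) (S' x) = reflect (-1) M (\<lambda>x. - reaction \<Lambda> (D x) (S x)) x"
    proof (rule reflect_cases[OF M, of x])
      fix y assume *: "\<And>f \<sigma>. reflect \<sigma> M f x = f y"
      show ?thesis unfolding S'_def D'_def * by simp
    next
      fix y assume *: "\<And>f \<sigma>. reflect \<sigma> M f x = \<sigma> * f y"
      show ?thesis unfolding S'_def D'_def * by (simp add: reaction_def)
    qed
    then show "- reaction \<Lambda> (S' x) (D' x) = reflect 1 M (\<lambda>x. - reaction \<Lambda> (S x) (D x)) x"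
      "- reaction \<Lambda> (D' x) (S' x) = reflect (-1) M (\<lambda>x. - reaction \<Lambda> (D x) (S x)) x" by auto
  qed
  show ?thesis
  proof (rule that[of S' "reflect (-1) M P" D' "reflect 1 M R"])
    fix x
    show "(S' has_real_derivative reflect (-1) M P x) (at x)"
      unfolding S'_def by (rule reflect_deriv[OF M]) (use S in \<open>auto simp: jet_def\<close>)
    have "(reflect (-1) M P has_real_derivative
       reflect (- (-1)) M (\<lambda>x. - reaction \<Lambda> (S x) (D x)) x) (at x)"
      by (rule reflect_deriv[OF M]) (use S in \<open>auto simp: jet_def\<close>)
    then show "(reflect (-1) M P has_real_derivative - reaction \<Lambda> (S' x) (D' x)) (at x)"
      by (simp add: r)
    have "(D' has_real_derivative reflect (- (-1)) M R x) (at x)"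
      unfolding D'_def by (rule reflect_deriv[OF M]) (use D in \<open>auto simp: jet_def\<close>)
    then show "(D' has_real_derivative reflect 1 M R x) (at x)" by simp
    show "(reflect 1 M R has_real_derivative - reaction \<Lambda> (D' x) (S' x)) (at x)"
      unfolding r by (rule reflect_deriv[OF M]) (use D in \<open>auto simp: jet_def reaction_def\<close>)
    have "\<bar>D y\<bar> < S y" if "y \<in> {0..M}" for y
      using admissible_bounds(3)[OF a that] difference_below_sum[OF S(1) D a that] by simp
    note less = this
    show "\<bar>D' x\<bar> < S' x"
    proof (rule reflect_cases[OF M, of x])
      fix y assume y: "y \<in> {0..M}" and *: "\<And>f \<sigma>. reflect \<sigma> M f x = f y"
      show ?thesis unfolding S'_def D'_def * by (rule less[OF y])
    next
      fix y assume y: "y \<in> {0..M}" and *: "\<And>f \<sigma>. reflect \<sigma> M f x = \<sigma> * f y"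
      show ?thesis unfolding S'_def D'_def * using less[OF y] by simp
    qed
  next
    fix x assume x: "0 < x" "x < M"
    then have "D' x = D x"
      using reflect_on_cell[OF M, of D "-1" x 0] D by (simp add: D'_def)
    also have "\<dots> \<ge> d0 x" using a x by (auto simp: admissible_def)
    finally show "D' x > 0" using d0_pos[OF x] by simp
  next
    fix n
    have "of_int n * M / M = of_int n" using M by simp
    then show "D' (of_int n * M) = 0"
      using D by (simp add: D'_def reflect_def Let_def algebra_simps)
  qed
qed

section \<open>Functions of one coordinate\<close>

lemma lift_has_derivative:
  assumes "\<And>t. (f has_real_derivative f' t) (at t)"
  shows "((\<lambda>x :: real^'n. f (x $ i)) has_derivative (\<lambda>h. f' (x $ i) * h $ i)) (at x)"
proof -
  have "((\<lambda>x :: real^'n. x $ i) has_derivative (\<lambda>h. h $ i)) (at x)"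
    by (intro bounded_linear_imp_has_derivative bounded_linear_vec_nth)
  then show ?thesis
    using has_derivative_compose[of "\<lambda>x. x $ i" _ x UNIV f] assms[of "x $ i"]
    by (simp add: has_field_derivative_def)
qed

lemma partial_deriv_lift:
  assumes "\<And>t. (f has_real_derivative f' t) (at t)"
  shows "partial_deriv j (\<lambda>x :: real^'n::finite. f (x $ i)) = (\<lambda>x. if j = i then f' (x $ i) else 0)"
proof
  fix x :: "real^'n"
  show "partial_deriv j (\<lambda>x. f (x $ i)) x = (if j = i then f' (x $ i) else 0)"
    unfolding partial_deriv_def frechet_derivative_at[OF lift_has_derivative[OF assms], symmetric]
    by (simp add: axis_def)
qed

lemma C1_lift:
  assumes d: "\<And>t. (f has_real_derivative f' t) (at t)" and c: "continuous_on UNIV f'"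
  shows "C1_fun (\<lambda>x :: real^'n::finite. f (x $ i))"
proof -
  have "continuous_on UNIV (\<lambda>x :: real^'n. f' (x $ i))"
    by (rule continuous_on_compose2[OF c]) (auto intro!: continuous_intros)
  then have "continuous_on UNIV (partial_deriv j (\<lambda>x :: real^'n. f (x $ i)))" for j
    unfolding partial_deriv_lift[OF d] by (cases "j = i") auto
  then show ?thesis
    using lift_has_derivative[OF d] unfolding C1_fun_def differentiable_def by blast
qed

lemma C2_lift:
  assumes d: "\<And>t. (f has_real_derivative f' t) (at t)"
    and d': "\<And>t. (f' has_real_derivative f'' t) (at t)" and c: "continuous_on UNIV f''"
  shows "C2_fun (\<lambda>x :: real^'n::finite. f (x $ i))"
    and "laplacian (\<lambda>x :: real^'n. f (x $ i)) x = f'' (x $ i)"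
proof -
  have c': "continuous_on UNIV f'" using d' by (auto intro: DERIV_continuous_on)
  have z: "C1_fun (\<lambda>x :: real^'n. 0)" using C1_lift[of "\<lambda>_. 0" "\<lambda>_. 0"] by simp
  have "C1_fun (partial_deriv j (\<lambda>x :: real^'n. f (x $ i)))" for j
    unfolding partial_deriv_lift[OF d] using C1_lift[OF d' c] z by (cases "j = i") auto
  then show "C2_fun (\<lambda>x :: real^'n::finite. f (x $ i))"
    using C1_lift[OF d c'] by (simp add: C2_fun_def)
  have "partial_deriv j (partial_deriv j (\<lambda>x :: real^'n. f (x $ i))) x = (if j = i then f'' (x $ i) else 0)" for j
    unfolding partial_deriv_lift[OF d]
    using partial_deriv_lift[OF d', of i i] partial_deriv_lift[of "\<lambda>_. 0" "\<lambda>_. 0" j i] by (cases "j = i") auto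
  then show "laplacian (\<lambda>x :: real^'n. f (x $ i)) x = f'' (x $ i)"
    by (simp add: laplacian_def)
qed

section \<open>An invariant under rigid motions\<close>

text \<open>The coincidence set \<open>u = v\<close> is symmetric in \<open>u\<close> and \<open>v\<close> and moves along with rigid motions, so the
radii of open balls that avoid it can tell solutions apart.\<close>

definition separates :: "(real^'n::finite \<Rightarrow> real) \<times> (real^'n \<Rightarrow> real) \<Rightarrow> real \<Rightarrow> bool" where
  "separates p r \<longleftrightarrow> (\<exists>x. \<forall>y. dist x y < r \<longrightarrow> fst p y \<noteq> snd p y)"

lemma isometry_surj:
  assumes "isometry (T :: real^'n::finite \<Rightarrow> real^'n)"
  shows "surj T"
proof -
  have "orthogonal_transformation (\<lambda>x. T x - T 0)"
    using assms by (simp add: orthogonal_transformation_isometry isometry_def dist_norm)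
  then have s: "surj (\<lambda>x. T x - T 0)" by (rule orthogonal_transformation_surj)
  have "\<exists>x. y = T x" for y
  proof -
    obtain x where "y - T 0 = T x - T 0" using surjD[OF s, of "y - T 0"] by blast
    then show ?thesis by auto
  qed
  then show ?thesis by (auto simp: surj_def)
qed

lemma separates_invariant:
  assumes "\<not> geometrically_distinct p q"
  shows "separates p r \<longleftrightarrow> separates q r"
proof -
  obtain u v u' v' where pq: "p = (u, v)" "q = (u', v')" by (cases p, cases q)
  obtain T where T: "isometry T" and "(u, v) = (u' \<circ> T, v' \<circ> T) \<or> (v, u) = (u' \<circ> T, v' \<circ> T)"
    using assms by (auto simp: geometrically_distinct_def pq)
  then have eq: "u y \<noteq> v y \<longleftrightarrow> u' (T y) \<noteq> v' (T y)" for y by auto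
  have s: "surj T" by (rule isometry_surj[OF T])
  have dist: "dist (T x) (T y) = dist x y" for x y using T by (simp add: isometry_def)
  have "separates q r \<longleftrightarrow> (\<exists>x\<in>range T. \<forall>y\<in>range T. dist x y < r \<longrightarrow> u' y \<noteq> v' y)"
    unfolding separates_def pq s by simp
  also have "\<dots> \<longleftrightarrow> separates p r"
    unfolding separates_def pq by (simp add: eq dist)
  finally show ?thesis by simp
qed

section \<open>Infinitely many solutions\<close>

text \<open>The coincidence set of the lifted solution is the family of hyperplanes at distance \<open>M\<close> from each
other; the largest open balls avoiding it fill the gap between two neighbours. The half period can thus
be read off the solution.\<close>

lemma (in barriers) lifted_solution:
  "\<exists>p :: (real^'n::finite \<Rightarrow> real) \<times> (real^'n \<Rightarrow> real).
     classical_solution \<Lambda> p \<and> (\<forall>r. separates p r \<longleftrightarrow> r \<le> M / 2)"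
proof -
  obtain S S1 D D1 :: "real \<Rightarrow> real" where
    S: "\<And>x. (S has_real_derivative S1 x) (at x)"
      "\<And>x. (S1 has_real_derivative - reaction \<Lambda> (S x) (D x)) (at x)"
    and D: "\<And>x. (D has_real_derivative D1 x) (at x)"
      "\<And>x. (D1 has_real_derivative - reaction \<Lambda> (D x) (S x)) (at x)"
    and less: "\<And>x. \<bar>D x\<bar> < S x" and pos: "\<And>x. 0 < x \<Longrightarrow> x < M \<Longrightarrow> D x > 0"
    and zero: "\<And>n. D (of_int n * M) = 0"
    by (rule periodic_profile) blast
  fix i :: 'n
  define u where "u t = (S t + D t) / 2" for t
  define v where "v t = (S t - D t) / 2" for t
  define u1 where "u1 t = (S1 t + D1 t) / 2" for t
  define v1 where "v1 t = (S1 t - D1 t) / 2" for t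
  have SD: "S t = u t + v t" "D t = u t - v t" for t by (auto simp: u_def v_def field_simps)
  define u2 where "u2 t = - (u t - u t ^ 3 - \<Lambda> * u t * (v t)\<^sup>2)" for t
  define v2 where "v2 t = - (v t - v t ^ 3 - \<Lambda> * (u t)\<^sup>2 * v t)" for t
  have u2: "(- reaction \<Lambda> (S t) (D t) + - reaction \<Lambda> (D t) (S t)) / 2 = u2 t" for t
    unfolding u2_def reaction_uv(1)[symmetric] SD by (simp add: field_simps)
  have v2: "(- reaction \<Lambda> (S t) (D t) - - reaction \<Lambda> (D t) (S t)) / 2 = v2 t" for t
    unfolding v2_def reaction_uv(2)[symmetric] SD by (simp add: field_simps)
  have u: "(u has_real_derivative u1 t) (at t)" "(u1 has_real_derivative u2 t) (at t)" for t
    unfolding u2[symmetric] unfolding u_def u1_def by (intro DERIV_cdivide DERIV_add S D)+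
  have v: "(v has_real_derivative v1 t) (at t)" "(v1 has_real_derivative v2 t) (at t)" for t
    unfolding v2[symmetric] unfolding v_def v1_def by (intro DERIV_cdivide DERIV_diff S D)+
  have c: "continuous_on UNIV u" "continuous_on UNIV v"
    using u(1) v(1) by (auto intro: DERIV_continuous_on)
  have c2: "continuous_on UNIV u2" "continuous_on UNIV v2"
    unfolding u2_def v2_def by (intro continuous_intros c)+
  have uv_pos: "u t > 0" "v t > 0" for t using less[of t] by (auto simp: u_def v_def)
  define p where "p = (\<lambda>x :: real^'n. u (x $ i), \<lambda>x :: real^'n. v (x $ i))"
  have "classical_solution \<Lambda> p"
    unfolding classical_solution_def p_def
    using uv_pos by (simp add: C2_lift[OF u c2(1)] C2_lift[OF v c2(2)] u2_def v2_def)
  moreover have "separates p r \<longleftrightarrow> r \<le> M / 2" for r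
  proof
    assume r: "r \<le> M / 2"
    have "u (y $ i) \<noteq> v (y $ i)" if "dist (axis i (M / 2)) y < r" for y
    proof -
      have "\<bar>(axis i (M / 2) - y) $ i\<bar> \<le> norm (axis i (M / 2) - y)" by (rule component_le_norm_cart)
      then have "\<bar>M / 2 - y $ i\<bar> < M / 2" using that r by (simp add: dist_norm axis_def)
      then have "0 < y $ i" "y $ i < M" by linarith+
      then have "D (y $ i) > 0" by (rule pos)
      then show ?thesis by (simp add: SD)
    qed
    then show "separates p r" unfolding separates_def p_def by (intro exI[of _ "axis i (M / 2)"]) simp
  next
    assume "separates p r"
    then obtain x where x: "\<And>y. dist x y < r \<Longrightarrow> u (y $ i) \<noteq> v (y $ i)"
      unfolding separates_def p_def by auto
    \<comment> \<open>the nearest coincidence hyperplane is at distance at most M / 2\<close>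
    define n where "n = round (x $ i / M)"
    have "\<bar>of_int n - x $ i / M\<bar> \<le> 1 / 2" unfolding n_def by (rule of_int_round_abs_le)
    then have "\<bar>of_int n - x $ i / M\<bar> * M \<le> 1 / 2 * M" using M by (intro mult_right_mono) auto
    also have "\<bar>of_int n - x $ i / M\<bar> * M = \<bar>(of_int n - x $ i / M) * M\<bar>" using M by (simp add: abs_mult)
    also have "(of_int n - x $ i / M) * M = of_int n * M - x $ i" using M by (simp add: field_simps)
    finally have near: "\<bar>of_int n * M - x $ i\<bar> \<le> M / 2" by simp
    define y where "y = x + (of_int n * M - x $ i) *\<^sub>R axis i 1"
    have "y $ i = of_int n * M" by (simp add: y_def axis_def)
    then have "u (y $ i) = v (y $ i)" using zero[of n] SD(2)[of "of_int n * M"] by simp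
    then have "\<not> dist x y < r" using x by blast
    moreover have "dist x y = \<bar>of_int n * M - x $ i\<bar>"
      by (simp add: y_def dist_norm norm_axis_1)
    ultimately show "r \<le> M / 2" using near by simp
  qed
  ultimately show ?thesis by blast
qed

text \<open>The bound \<open>g\<close> on \<open>\<epsilon>\<close> is the amplitude at which the frequency condition becomes an equality.\<close>

lemma barriers_exist:
  assumes "\<Lambda> > 1" "M > 0" and "(pi / M)\<^sup>2 < 2 * (\<Lambda> - 1) / (\<Lambda> + 1)"
  shows "\<exists>\<epsilon>. barriers \<Lambda> M \<epsilon>"
proof -
  define g where "g = sqrt (4 / (1 + \<Lambda>) * (2 * (\<Lambda> - 1) / (\<Lambda> + 1) - (pi / M)\<^sup>2))"
  define \<epsilon> where "\<epsilon> = min 1 (min (2 / sqrt (1 + \<Lambda>)) g)"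
  have "4 / (1 + \<Lambda>) * (2 * (\<Lambda> - 1) / (\<Lambda> + 1) - (pi / M)\<^sup>2) > 0"
    using assms by (intro mult_pos_pos) auto
  then have g: "g > 0" "g\<^sup>2 = 4 / (1 + \<Lambda>) * (2 * (\<Lambda> - 1) / (\<Lambda> + 1) - (pi / M)\<^sup>2)"
    unfolding g_def by auto
  have \<epsilon>: "\<epsilon> > 0" "\<epsilon> \<le> 1" "\<epsilon> \<le> 2 / sqrt (1 + \<Lambda>)" "\<epsilon> \<le> g" using assms g by (auto simp: \<epsilon>_def)
  then have "\<epsilon>\<^sup>2 \<le> g\<^sup>2" by (intro power_mono) auto
  then have "(1 + \<Lambda>) / 4 * \<epsilon>\<^sup>2 \<le> (1 + \<Lambda>) / 4 * g\<^sup>2" using assms by (intro mult_left_mono) auto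
  also have "\<dots> = 2 * (\<Lambda> - 1) / (\<Lambda> + 1) - (pi / M)\<^sup>2"
  proof -
    have "(1 + \<Lambda>) / 4 * (4 / (1 + \<Lambda>)) = 1" using assms by simp
    then show ?thesis unfolding g(2) by (metis mult.assoc mult_1)
  qed
  finally have "(pi / M)\<^sup>2 + (1 + \<Lambda>) / 4 * \<epsilon>\<^sup>2 \<le> 2 * (\<Lambda> - 1) / (\<Lambda> + 1)" by linarith
  then show ?thesis unfolding barriers_def using \<epsilon> assms by blast
qed

theorem corollary1p2:
  fixes \<Lambda> :: real
  assumes "CARD('n::finite) \<ge> 2"
    and "\<Lambda> > 1"
  shows "\<exists>S :: ((real^'n \<Rightarrow> real) \<times> (real^'n \<Rightarrow> real)) set.
           infinite S \<and>
           (\<forall>p\<in>S. classical_solution \<Lambda> p \<and> \<not> constant_pair p) \<and>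
           pairwise geometrically_distinct S"
proof -
  define \<omega> where "\<omega> = sqrt (2 * (\<Lambda> - 1) / (\<Lambda> + 1))"
  have \<omega>: "\<omega> > 0" "\<omega>\<^sup>2 = 2 * (\<Lambda> - 1) / (\<Lambda> + 1)" using assms(2) by (auto simp: \<omega>_def)
  \<comment> \<open>half periods above the critical value pi / \<omega>\<close>
  define M where "M n = pi / \<omega> + 1 + real n" for n
  have M_pos: "M n > 0" for n
  proof -
    have "pi / \<omega> > 0" using \<omega> by simp
    then show ?thesis unfolding M_def using of_nat_0_le_iff[of n, where ?'a = real] by linarith
  qed
  have "\<exists>p :: (real^'n \<Rightarrow> real) \<times> (real^'n \<Rightarrow> real).
     classical_solution \<Lambda> p \<and> (\<forall>r. separates p r \<longleftrightarrow> r \<le> M n / 2)" for n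
  proof -
    have "M n > pi / \<omega>" by (simp add: M_def)
    then have "pi / M n < \<omega>" using \<omega> M_pos[of n] by (simp add: field_simps)
    then have "(pi / M n)\<^sup>2 < \<omega>\<^sup>2" using M_pos[of n] by (intro power_strict_mono) auto
    then obtain \<epsilon> where "barriers \<Lambda> (M n) \<epsilon>"
      using barriers_exist[OF assms(2) M_pos] \<omega>(2) by metis
    then show ?thesis by (rule barriers.lifted_solution)
  qed
  then obtain p :: "nat \<Rightarrow> (real^'n \<Rightarrow> real) \<times> (real^'n \<Rightarrow> real)" where
    p: "\<And>n. classical_solution \<Lambda> (p n)" "\<And>n r. separates (p n) r \<longleftrightarrow> r \<le> M n / 2"
    by metis
  have distinct: "geometrically_distinct (p m) (p n)" if "m \<noteq> n" for m n
  proof (rule ccontr)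
    assume "\<not> geometrically_distinct (p m) (p n)"
    from separates_invariant[OF this] have "r \<le> M m / 2 \<longleftrightarrow> r \<le> M n / 2" for r by (simp add: p)
    from this[of "M m / 2"] this[of "M n / 2"] show False using that by (simp add: M_def)
  qed
  have irrefl: "\<not> geometrically_distinct q q" for q :: "(real^'n \<Rightarrow> real) \<times> (real^'n \<Rightarrow> real)"
    by (cases q) (auto simp: geometrically_distinct_def isometry_def intro!: exI[of _ id])
  then have "inj p" using distinct unfolding inj_def by metis
  then have "infinite (range p)" using finite_imageD by blast
  moreover have "\<not> constant_pair (p n)" for n
  proof
    assume "constant_pair (p n)"
    then obtain a b where ab: "\<And>x. fst (p n) x = a" "\<And>x. snd (p n) x = b"
      by (cases "p n") (auto simp: constant_pair_def constant_on_def)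
    \<comment> \<open>a constant pair has empty or full coincidence set, so all radii above 0 behave alike\<close>
    have "separates (p n) (M n / 2)" using p(2) by simp
    then obtain x :: "real^'n" where "dist x x < M n / 2 \<longrightarrow> a \<noteq> b"
      unfolding separates_def ab by blast
    then have "a \<noteq> b" using M_pos[of n] by simp
    then have "separates (p n) (M n)" by (simp add: separates_def ab)
    then show False using M_pos[of n] p(2) by simp
  qed
  moreover have "pairwise geometrically_distinct (range p)"
    using distinct unfolding pairwise_def by (metis rangeE)
  ultimately show ?thesis using p(1) by (intro exI[of _ "range p"]) auto
qed

end
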